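(* Let $A=\langle A_\varepsilon\rangle$ and $B=[B_\varepsilon]$ be two non-empty and strongly disjoint subsets of $\mathcal{G}_E$. Assume that the nets $(A_\varepsilon)$, $(B_\varepsilon)$ are sharply bounded and consist of convex sets. Then there exist a continuous $\widetilde{\mathbb{R}}$-linear map $f=[f_\varepsilon]:\mathcal{G}_E\to\widetilde{\mathbb{R}}$ (with representatives), non-identically null, and $\alpha\in\widetilde{\mathbb{R}}$ such that $$\forall y\in A\ \forall z\in B:\ f(y)\le\alpha\le f(z),$$ i.e. the closed hyperplane $\{f=\alpha\}$ separates $A$ and $B$. Moreover, if $B$ is a cone, i.e. $\lambda x\in B$ for all $x\in B$ and all $\lambda\in\widetilde{\mathbb{R}}_{\ge0}$, then one can choose $\alpha=0$.
   Context: Let $I=(0,1]$ and fix a gauge, i.e. a net $\rho=(\rho_\varepsilon)\in I^I$ with $\rho_\varepsilon\to0$ as $\varepsilon\to0^+$. "For all $\varepsilon$ small" means for all $\varepsilon\in(0,\varepsilon_0]$ for some $\varepsilon_0\in I$. $E=(E_\varepsilon,\|\cdot\|_\varepsilon)_{\varepsilon\in I}$ is a family of real normed spaces; $\mathcal{M}_E=\{(u_\varepsilon)\in\prod_\varepsilon E_\varepsilon\mid\exists N\in\mathbb{N}:\|u_\varepsilon\|_\varepsilon=O(\rho_\varepsilon^{-N})\}$, $\mathcal{N}_E=\{(u_\varepsilon)\in\prod_\varepsilon E_\varepsilon\mid\forall N\in\mathbb{N}:\|u_\varepsilon\|_\varepsilon=O(\rho_\varepsilon^{N})\}$, $\mathcal{G}_E=\mathcal{M}_E/\mathcal{N}_E$,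 with classes $[u_\varepsilon]$. $\widetilde{\mathbb{R}}$ is the case $E_\varepsilon=\mathbb{R}$ (nets $\mathcal{M}_{\mathbb{R}},\mathcal{N}_{\mathbb{R}}$); $\mathcal{G}_E$ is an $\widetilde{\mathbb{R}}$-module. Order: $x\le y$ iff for any representative $(x_\varepsilon)$ of $x$ there is a representative $(y_\varepsilon)$ of $y$ with $x_\varepsilon\le y_\varepsilon$ for all $\varepsilon$ small; $x>0$ iff $x\ge0$ and $x$ is invertible. $\|u\|=[\|u_\varepsilon\|_\varepsilon]\in\widetilde{\mathbb{R}}$. Topologies (sharp topology): generated by balls $B_r(u)=\{v:\|u-v\|<r\}$, $r\in\widetilde{\mathbb{R}}_{>0}$, on $\mathcal{G}_E$ and similarly on $\widetilde{\mathbb{R}}$ with $|\cdot|$. For $A_\varepsilon\subseteq E_\varepsilon$: $[A_\varepsilon]$ is the set of $u\in\mathcal{G}_E$ for which there exists a representative with $u_\varepsilon\in A_\varepsilon$ for all $\varepsilon$ small (internal set); $\langle A_\varepsilon\rangle$ is the set of $u\in\mathcal{G}_E$ such that every representative satisfies $u_\varepsilon\in A_\varepsilon$ for all $\varepsilon$ small (strongly internal set). $(A_\varepsilon)$ is sharply bounded if there is $N\in\mathbb{N}$ such that for all $\varepsilon$ small and all $u\in A_\varepsilon$, $\|u\|_\varepsilon\le\rho_\varepsilon^{-N}$. $L\subseteq_0 I$ means $L\subseteq I$ and $0\in\overline{L}$; $\mathcal{G}_E|_L$ is the same quotient with index set $L$ instead of $I$, $u|_L$ is the restriction of $u$, $A|_L=\{u|_L: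 u\in A\}$. $A,B$ are strongly disjoint if $A|_L\cap B|_L=\emptyset$ for all $L\subseteq_0 I$. $f=[f_\varepsilon]$ has representatives if $f_\varepsilon:E_\varepsilon\to\mathbb{R}$ are linear, map moderate nets to moderate nets and negligible nets to negligible nets, and $f([u_\varepsilon])=[f_\varepsilon(u_\varepsilon)]$. $f$ is non-identically null if $|f(x)|>0$ for some $x$. A hyperplane is a set $\{f=\alpha\}=\{u: f(u)=\alpha\}$ with $f$ linear non-identically null. *)

theory Defs
  imports "HOL-Analysis.Analysis" "HOL-Library.Landau_Symbols"
begin

abbreviation idx :: "real set" where
  "idx \<equiv> {0<..1}"

definition gauge_net :: "(real \<Rightarrow> real) \<Rightarrow> bool" where
  "gauge_net \<rho> \<longleftrightarrow> \<rho> \<in> idx \<rightarrow> idx \<and> (\<rho> \<longlongrightarrow> 0) (at 0 within idx)"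

text \<open>
  A family of real normed spaces is encoded by linear subspaces \<open>Car E \<epsilon>\<close> of one ambient real
  vector space, each with its own norm \<open>nm E \<epsilon>\<close>. This is no restriction: every family of vector
  spaces embeds into its direct sum. The values of \<open>nm E \<epsilon>\<close> off \<open>Car E \<epsilon>\<close> are irrelevant.
\<close>

record 'a nfam =
  Car :: "real \<Rightarrow> 'a set"
  nm :: "real \<Rightarrow> 'a \<Rightarrow> real"

definition normed_family :: "('a::real_vector) nfam \<Rightarrow> bool" where
  "normed_family E \<longleftrightarrow> (\<forall>\<epsilon>\<in>idx. subspace (Car E \<epsilon>)
     \<and> (\<forall>x\<in>Car E \<epsilon>. 0 \<le> nm E \<epsilon> x \<and> (nm E \<epsilon> x = 0 \<longleftrightarrow> x = 0))
     \<and> (\<forall>x\<in>Car E \<epsilon>. \<forall>y\<in>Car E \<epsilon>. nm E \<epsilon> (x + y) \<le> nm E \<epsilon> x + nm E \<epsilon> y)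
     \<and> (\<forall>c. \<forall>x\<in>Car E \<epsilon>. nm E \<epsilon> (c *\<^sub>R x) = \<bar>c\<bar> * nm E \<epsilon> x))"

definition Rfam :: "real nfam" where
  "Rfam = \<lparr>Car = \<lambda>_. UNIV, nm = \<lambda>_ x. \<bar>x\<bar>\<rparr>"

text \<open>
  Nets over an index set \<open>L \<subseteq> idx\<close> are extensional functions. Since \<open>0 \<notin> L\<close>, a property holds
  eventually in the filter \<open>at 0 within L\<close> iff it holds for all small \<open>\<epsilon> \<in> L\<close>.
\<close>

definition moderate :: "(real \<Rightarrow> real) \<Rightarrow> ('a::real_vector) nfam \<Rightarrow> real set \<Rightarrow> (real \<Rightarrow> 'a) set" where
  "moderate \<rho> E L = {u \<in> Pi\<^sub>E L (Car E).
     \<exists>N::nat. (\<lambda>\<epsilon>. nm E \<epsilon> (u \<epsilon>)) \<in> O[at 0 within L](\<lambda>\<epsilon>. inverse (\<rho> \<epsilon> ^ N))}"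

definition negligible :: "(real \<Rightarrow> real) \<Rightarrow> ('a::real_vector) nfam \<Rightarrow> real set \<Rightarrow> (real \<Rightarrow> 'a) set" where
  "negligible \<rho> E L = {u \<in> Pi\<^sub>E L (Car E).
     \<forall>N::nat. (\<lambda>\<epsilon>. nm E \<epsilon> (u \<epsilon>)) \<in> O[at 0 within L](\<lambda>\<epsilon>. \<rho> \<epsilon> ^ N)}"

definition grel :: "(real \<Rightarrow> real) \<Rightarrow> ('a::real_vector) nfam \<Rightarrow> real set
    \<Rightarrow> ((real \<Rightarrow> 'a) \<times> (real \<Rightarrow> 'a)) set" where
  "grel \<rho> E L = {(u, v). u \<in> moderate \<rho> E L \<and> v \<in> moderate \<rho> E L
     \<and> (\<lambda>\<epsilon>\<in>L. u \<epsilon> - v \<epsilon>) \<in> negligible \<rho> E L}"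

definition G :: "(real \<Rightarrow> real) \<Rightarrow> ('a::real_vector) nfam \<Rightarrow> real set \<Rightarrow> (real \<Rightarrow> 'a) set set" where
  "G \<rho> E L = moderate \<rho> E L // grel \<rho> E L"

definition cls :: "(real \<Rightarrow> real) \<Rightarrow> ('a::real_vector) nfam \<Rightarrow> real set \<Rightarrow> (real \<Rightarrow> 'a)
    \<Rightarrow> (real \<Rightarrow> 'a) set" where
  "cls \<rho> E L u = grel \<rho> E L `` {restrict u L}"

abbreviation Rt :: "(real \<Rightarrow> real) \<Rightarrow> (real \<Rightarrow> real) set set" where
  "Rt \<rho> \<equiv> G \<rho> Rfam idx"

text \<open>
  Operations on classes are unions over all representatives; all the classes in such a union
  coincide, so this is the usual representative-wise definition.
\<close>

definition gadd :: "(real \<Rightarrow> real) \<Rightarrow> ('a::real_vector) nfam \<Rightarrow> (real \<Rightarrow> 'a) set \<Rightarrow> (real \<Rightarrow> 'a) set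
    \<Rightarrow> (real \<Rightarrow> 'a) set" where
  "gadd \<rho> E x y = (\<Union>u\<in>x. \<Union>v\<in>y. cls \<rho> E idx (\<lambda>\<epsilon>. u \<epsilon> + v \<epsilon>))"

definition gdiff :: "(real \<Rightarrow> real) \<Rightarrow> ('a::real_vector) nfam \<Rightarrow> (real \<Rightarrow> 'a) set \<Rightarrow> (real \<Rightarrow> 'a) set
    \<Rightarrow> (real \<Rightarrow> 'a) set" where
  "gdiff \<rho> E x y = (\<Union>u\<in>x. \<Union>v\<in>y. cls \<rho> E idx (\<lambda>\<epsilon>. u \<epsilon> - v \<epsilon>))"

definition gscale :: "(real \<Rightarrow> real) \<Rightarrow> ('a::real_vector) nfam \<Rightarrow> (real \<Rightarrow> real) set \<Rightarrow> (real \<Rightarrow> 'a) set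
    \<Rightarrow> (real \<Rightarrow> 'a) set" where
  "gscale \<rho> E c x = (\<Union>a\<in>c. \<Union>u\<in>x. cls \<rho> E idx (\<lambda>\<epsilon>. a \<epsilon> *\<^sub>R u \<epsilon>))"

definition gnorm :: "(real \<Rightarrow> real) \<Rightarrow> ('a::real_vector) nfam \<Rightarrow> (real \<Rightarrow> 'a) set
    \<Rightarrow> (real \<Rightarrow> real) set" where
  "gnorm \<rho> E x = (\<Union>u\<in>x. cls \<rho> Rfam idx (\<lambda>\<epsilon>. nm E \<epsilon> (u \<epsilon>)))"

definition grestrict :: "(real \<Rightarrow> real) \<Rightarrow> ('a::real_vector) nfam \<Rightarrow> real set \<Rightarrow> (real \<Rightarrow> 'a) set
    \<Rightarrow> (real \<Rightarrow> 'a) set" where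
  "grestrict \<rho> E L x = (\<Union>u\<in>x. cls \<rho> E L u)"

definition rconst :: "(real \<Rightarrow> real) \<Rightarrow> real \<Rightarrow> (real \<Rightarrow> real) set" where
  "rconst \<rho> c = cls \<rho> Rfam idx (\<lambda>_. c)"

definition rle :: "(real \<Rightarrow> real) set \<Rightarrow> (real \<Rightarrow> real) set \<Rightarrow> bool" where
  "rle x y \<longleftrightarrow> (\<forall>u\<in>x. \<exists>v\<in>y. \<forall>\<^sub>F \<epsilon> in at 0 within idx. u \<epsilon> \<le> v \<epsilon>)"

text \<open>The ring multiplication of \<open>Rt \<rho>\<close> is the scalar action \<open>gscale \<rho> Rfam\<close> on itself.\<close>

definition rinvertible :: "(real \<Rightarrow> real) \<Rightarrow> (real \<Rightarrow> real) set \<Rightarrow> bool" where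
  "rinvertible \<rho> x \<longleftrightarrow> (\<exists>y\<in>Rt \<rho>. gscale \<rho> Rfam x y = rconst \<rho> 1)"

definition rpos :: "(real \<Rightarrow> real) \<Rightarrow> (real \<Rightarrow> real) set \<Rightarrow> bool" where
  "rpos \<rho> x \<longleftrightarrow> rle (rconst \<rho> 0) x \<and> rinvertible \<rho> x"

definition rless :: "(real \<Rightarrow> real) \<Rightarrow> (real \<Rightarrow> real) set \<Rightarrow> (real \<Rightarrow> real) set \<Rightarrow> bool" where
  "rless \<rho> x y \<longleftrightarrow> rpos \<rho> (gdiff \<rho> Rfam y x)"

definition gball :: "(real \<Rightarrow> real) \<Rightarrow> ('a::real_vector) nfam \<Rightarrow> (real \<Rightarrow> real) set \<Rightarrow> (real \<Rightarrow> 'a) set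
    \<Rightarrow> (real \<Rightarrow> 'a) set set" where
  "gball \<rho> E r u = {v \<in> G \<rho> E idx. rless \<rho> (gnorm \<rho> E (gdiff \<rho> E u v)) r}"

definition sharp_topology :: "(real \<Rightarrow> real) \<Rightarrow> ('a::real_vector) nfam
    \<Rightarrow> (real \<Rightarrow> 'a) set topology" where
  "sharp_topology \<rho> E = topology_generated_by
     {gball \<rho> E r u |r u. r \<in> Rt \<rho> \<and> rpos \<rho> r \<and> u \<in> G \<rho> E idx}"

definition internal :: "(real \<Rightarrow> real) \<Rightarrow> ('a::real_vector) nfam \<Rightarrow> (real \<Rightarrow> 'a set)
    \<Rightarrow> (real \<Rightarrow> 'a) set set" where
  "internal \<rho> E A = {x \<in> G \<rho> E idx. \<exists>u\<in>x. \<forall>\<^sub>F \<epsilon> in at 0 within idx. u \<epsilon> \<in> A \<epsilon>}"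

definition strongly_internal :: "(real \<Rightarrow> real) \<Rightarrow> ('a::real_vector) nfam \<Rightarrow> (real \<Rightarrow> 'a set)
    \<Rightarrow> (real \<Rightarrow> 'a) set set" where
  "strongly_internal \<rho> E A = {x \<in> G \<rho> E idx. \<forall>u\<in>x. \<forall>\<^sub>F \<epsilon> in at 0 within idx. u \<epsilon> \<in> A \<epsilon>}"

definition sharply_bounded :: "(real \<Rightarrow> real) \<Rightarrow> ('a::real_vector) nfam \<Rightarrow> (real \<Rightarrow> 'a set)
    \<Rightarrow> bool" where
  "sharply_bounded \<rho> E A \<longleftrightarrow>
     (\<exists>N::nat. \<forall>\<^sub>F \<epsilon> in at 0 within idx. \<forall>u\<in>A \<epsilon>. nm E \<epsilon> u \<le> inverse (\<rho> \<epsilon> ^ N))"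

definition strongly_disjoint :: "(real \<Rightarrow> real) \<Rightarrow> ('a::real_vector) nfam
    \<Rightarrow> (real \<Rightarrow> 'a) set set \<Rightarrow> (real \<Rightarrow> 'a) set set \<Rightarrow> bool" where
  "strongly_disjoint \<rho> E X Y \<longleftrightarrow>
     (\<forall>L. L \<subseteq> idx \<and> 0 \<in> closure L \<longrightarrow> grestrict \<rho> E L ` X \<inter> grestrict \<rho> E L ` Y = {})"

definition gcone :: "(real \<Rightarrow> real) \<Rightarrow> ('a::real_vector) nfam \<Rightarrow> (real \<Rightarrow> 'a) set set \<Rightarrow> bool" where
  "gcone \<rho> E X \<longleftrightarrow> (\<forall>x\<in>X. \<forall>c\<in>Rt \<rho>. rle (rconst \<rho> 0) c \<longrightarrow> gscale \<rho> E c x \<in> X)"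

definition Rt_linear :: "(real \<Rightarrow> real) \<Rightarrow> ('a::real_vector) nfam
    \<Rightarrow> ((real \<Rightarrow> 'a) set \<Rightarrow> (real \<Rightarrow> real) set) \<Rightarrow> bool" where
  "Rt_linear \<rho> E f \<longleftrightarrow> f \<in> G \<rho> E idx \<rightarrow> Rt \<rho>
     \<and> (\<forall>x\<in>G \<rho> E idx. \<forall>y\<in>G \<rho> E idx. f (gadd \<rho> E x y) = gadd \<rho> Rfam (f x) (f y))
     \<and> (\<forall>c\<in>Rt \<rho>. \<forall>x\<in>G \<rho> E idx. f (gscale \<rho> E c x) = gscale \<rho> Rfam c (f x))"

definition represented_by :: "(real \<Rightarrow> real) \<Rightarrow> ('a::real_vector) nfam
    \<Rightarrow> ((real \<Rightarrow> 'a) set \<Rightarrow> (real \<Rightarrow> real) set) \<Rightarrow> (real \<Rightarrow> 'a \<Rightarrow> real) \<Rightarrow> bool" where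
  "represented_by \<rho> E f \<phi> \<longleftrightarrow>
     (\<forall>\<epsilon>\<in>idx. (\<forall>x\<in>Car E \<epsilon>. \<forall>y\<in>Car E \<epsilon>. \<phi> \<epsilon> (x + y) = \<phi> \<epsilon> x + \<phi> \<epsilon> y)
        \<and> (\<forall>c. \<forall>x\<in>Car E \<epsilon>. \<phi> \<epsilon> (c *\<^sub>R x) = c * \<phi> \<epsilon> x))
     \<and> (\<forall>u\<in>moderate \<rho> E idx. (\<lambda>\<epsilon>\<in>idx. \<phi> \<epsilon> (u \<epsilon>)) \<in> moderate \<rho> Rfam idx)
     \<and> (\<forall>u\<in>negligible \<rho> E idx. (\<lambda>\<epsilon>\<in>idx. \<phi> \<epsilon> (u \<epsilon>)) \<in> negligible \<rho> Rfam idx)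
     \<and> (\<forall>u\<in>moderate \<rho> E idx. f (cls \<rho> E idx u) = cls \<rho> Rfam idx (\<lambda>\<epsilon>. \<phi> \<epsilon> (u \<epsilon>)))"

definition non_identically_null :: "(real \<Rightarrow> real) \<Rightarrow> ('a::real_vector) nfam
    \<Rightarrow> ((real \<Rightarrow> 'a) set \<Rightarrow> (real \<Rightarrow> real) set) \<Rightarrow> bool" where
  "non_identically_null \<rho> E f \<longleftrightarrow> (\<exists>x\<in>G \<rho> E idx. rpos \<rho> (gnorm \<rho> Rfam (f x)))"

definition level_set :: "(real \<Rightarrow> real) \<Rightarrow> ('a::real_vector) nfam
    \<Rightarrow> ((real \<Rightarrow> 'a) set \<Rightarrow> (real \<Rightarrow> real) set) \<Rightarrow> (real \<Rightarrow> real) set \<Rightarrow> (real \<Rightarrow> 'a) set set" where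
  "level_set \<rho> E f \<alpha> = {u \<in> G \<rho> E idx. f u = \<alpha>}"

end

theory Submission
  imports Defs
begin

text \<open>
  Let \<open>A\<^sup>n\<close> consist of the points of \<open>A \<epsilon>\<close> whose closed \<open>\<rho> \<epsilon> ^ n\<close>-ball lies in \<open>A \<epsilon>\<close>. A class is in the
  strongly internal set iff its representatives eventually lie in some fixed \<open>A\<^sup>n\<close>, and strong
  disjointness says that for every \<open>n\<close> eventually \<open>A\<^sup>n\<close> misses \<open>B \<epsilon>\<close>: otherwise a point of \<open>A\<^sup>n \<inter> B \<epsilon>\<close>
  for each \<open>\<epsilon>\<close> of a set accumulating at 0 gives elements of the two sets agreeing there. Hence
  \<open>C \<epsilon>\<close>, the union of those \<open>A\<^sup>n\<close> that miss \<open>B \<epsilon>\<close>, is convex, disjoint from \<open>B \<epsilon>\<close>, and eventually contains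
  the representatives of every element of the strongly internal set. As \<open>C \<epsilon>\<close> contains a
  \<open>\<rho> \<epsilon> ^ m\<close>-ball around \<open>a \<epsilon>\<close>, Hahn--Banach separates \<open>C \<epsilon>\<close> from \<open>B \<epsilon>\<close> by a functional
  normalised by the value 1 at \<open>b \<epsilon> - a \<epsilon>\<close>; its norm is then at most \<open>1 / \<rho> \<epsilon> ^ m\<close>, so the net of
  functionals is moderate and not identically null. If the internal set is a cone, then scaling by
  the infinitely large numbers \<open>1 / \<rho> \<epsilon> ^ k\<close> shows that \<open>\<alpha>\<close> may be replaced by 0.
\<close>

section \<open>Separation in a single normed space\<close>

definition blunt_cone :: "'a::real_vector set \<Rightarrow> bool" where
  "blunt_cone M \<longleftrightarrow> 0 \<notin> M \<and> (\<forall>x\<in>M. \<forall>y\<in>M. x + y \<in> M) \<and> (\<forall>x\<in>M. \<forall>c>0. c *\<^sub>R x \<in> M)"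

definition linear_on_set :: "'a::real_vector set \<Rightarrow> ('a \<Rightarrow> real) \<Rightarrow> bool" where
  "linear_on_set V f \<longleftrightarrow> (\<forall>x\<in>V. \<forall>y\<in>V. f (x + y) = f x + f y) \<and> (\<forall>c. \<forall>x\<in>V. f (c *\<^sub>R x) = c * f x)"

lemma blunt_coneD:
  assumes "blunt_cone M"
  shows "0 \<notin> M" "\<And>x y. x \<in> M \<Longrightarrow> y \<in> M \<Longrightarrow> x + y \<in> M" "\<And>x c. x \<in> M \<Longrightarrow> c > 0 \<Longrightarrow> c *\<^sub>R x \<in> M"
  using assms by (auto simp: blunt_cone_def)

lemma blunt_cone_extend:
  assumes M: "blunt_cone M" and v: "v \<noteq> 0" "- v \<notin> M"
  shows "blunt_cone ({c *\<^sub>R v |c. c > 0} \<union> {m + c *\<^sub>R v |m c. m \<in> M \<and> c \<ge> 0})"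
    (is "blunt_cone (?P \<union> ?Q)")
proof -
  note D = blunt_coneD[OF M]
  have Q: "m + c *\<^sub>R v \<in> ?P \<union> ?Q" if "m \<in> M" "c \<ge> 0" for m c using that by blast
  have P: "c *\<^sub>R v \<in> ?P \<union> ?Q" if "c > 0" for c using that by blast
  have "0 \<notin> ?Q"
  proof
    assume "0 \<in> ?Q"
    then obtain m c where m: "m \<in> M" "c \<ge> 0" "m + c *\<^sub>R v = 0" by auto
    have "c \<noteq> 0" using m D(1) by auto
    hence "(1/c) *\<^sub>R m \<in> M" using D(3) m by simp
    moreover have "m = - (c *\<^sub>R v)" using m(3) by (simp add: eq_neg_iff_add_eq_0)
    hence "(1/c) *\<^sub>R m = - v" using \<open>c \<noteq> 0\<close> by simp
    ultimately show False using v by simp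
  qed
  moreover have "0 \<notin> ?P" using v by auto
  moreover have "x + y \<in> ?P \<union> ?Q" if xy: "x \<in> ?P \<union> ?Q" "y \<in> ?P \<union> ?Q" for x y
  proof -
    consider c d where "x = c *\<^sub>R v" "y = d *\<^sub>R v" "c > 0" "d > 0"
      | c m d where "x = c *\<^sub>R v" "y = m + d *\<^sub>R v" "c > 0" "d \<ge> 0" "m \<in> M"
      | c m d where "y = c *\<^sub>R v" "x = m + d *\<^sub>R v" "c > 0" "d \<ge> 0" "m \<in> M"
      | m c n d where "x = m + c *\<^sub>R v" "y = n + d *\<^sub>R v" "c \<ge> 0" "d \<ge> 0" "m \<in> M" "n \<in> M"
      using xy by blast
    then show ?thesis
    proof cases
      case 1
      then show ?thesis using P[of "c + d"] by (simp add: scaleR_add_left)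
    next
      case 2
      then show ?thesis using Q[of m "c + d"] by (simp add: scaleR_add_left algebra_simps)
    next
      case 3
      then show ?thesis using Q[of m "c + d"] by (simp add: scaleR_add_left algebra_simps)
    next
      case 4
      then show ?thesis using Q[OF D(2)[of m n], of "c + d"] by (simp add: scaleR_add_left algebra_simps)
    qed
  qed
  moreover have "c *\<^sub>R x \<in> ?P \<union> ?Q" if x: "x \<in> ?P \<union> ?Q" and c: "c > 0" for x c
  proof -
    consider d where "x = d *\<^sub>R v" "d > 0" | m d where "x = m + d *\<^sub>R v" "m \<in> M" "d \<ge> 0"
      using x by blast
    then show ?thesis
    proof cases
      case 1
      then show ?thesis using P[of "c * d"] c by simp
    next
      case 2
      then show ?thesis using Q[OF D(3)[of m c], of "c * d"] c by (simp add: scaleR_add_right)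
    qed
  qed
  ultimately show ?thesis unfolding blunt_cone_def by blast
qed

text \<open>Zorn's lemma applies since the union of a chain of blunt cones is a blunt cone. A
  maximal cone is total: if \<open>v\<close> is nonzero and \<open>- v\<close> lies outside it,
  adjoining \<open>v\<close> gives no proper extension, so \<open>v\<close> is already
  inside.\<close>

lemma blunt_cone_total_extension:
  assumes V: "subspace V" and K: "blunt_cone K" "K \<subseteq> V"
  obtains M where "blunt_cone M" "K \<subseteq> M" "M \<subseteq> V" "\<And>v. v \<in> V \<Longrightarrow> v = 0 \<or> v \<in> M \<or> - v \<in> M"
proof -
  define \<A> where "\<A> = {M. blunt_cone M \<and> K \<subseteq> M \<and> M \<subseteq> V}"
  have "\<A> \<noteq> {}" using K unfolding \<A>_def by auto
  moreover have "\<Union>C \<in> \<A>" if C0: "C \<noteq> {}" and C: "subset.chain \<A> C" for C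
  proof -
    have sub: "C \<subseteq> \<A>" and tot: "\<And>X Y. X \<in> C \<Longrightarrow> Y \<in> C \<Longrightarrow> X \<subseteq> Y \<or> Y \<subseteq> X"
      using C unfolding subset_chain_def by auto
    have "x + y \<in> \<Union>C" if "x \<in> \<Union>C" "y \<in> \<Union>C" for x y
    proof -
      obtain X Y where XY: "X \<in> C" "Y \<in> C" "x \<in> X" "y \<in> Y" using \<open>x \<in> \<Union>C\<close> \<open>y \<in> \<Union>C\<close> by auto
      obtain Z where Z: "Z \<in> C" "x \<in> Z" "y \<in> Z" using tot[OF XY(1,2)] XY by auto
      then have "blunt_cone Z" using sub unfolding \<A>_def by auto
      then show ?thesis using blunt_coneD(2)[OF _ Z(2,3)] Z(1) by blast
    qed
    moreover have "c *\<^sub>R x \<in> \<Union>C" if "x \<in> \<Union>C" "c > 0" for x c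
      using that sub blunt_coneD(3) unfolding \<A>_def by blast
    moreover have "0 \<notin> \<Union>C" using sub blunt_coneD(1) unfolding \<A>_def by blast
    ultimately have "blunt_cone (\<Union>C)" unfolding blunt_cone_def by blast
    moreover have "K \<subseteq> \<Union>C" "\<Union>C \<subseteq> V" using C0 sub unfolding \<A>_def by blast+
    ultimately show ?thesis unfolding \<A>_def by simp
  qed
  ultimately have "\<exists>M\<in>\<A>. \<forall>X\<in>\<A>. M \<subseteq> X \<longrightarrow> X = M" by (rule subset_Zorn_nonempty)
  then obtain M where M: "M \<in> \<A>" and max: "\<And>X. X \<in> \<A> \<Longrightarrow> M \<subseteq> X \<Longrightarrow> X = M"
    by auto
  have M': "blunt_cone M" "K \<subseteq> M" "M \<subseteq> V" using M unfolding \<A>_def by auto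
  have "v \<in> M" if v: "v \<in> V" "v \<noteq> 0" "- v \<notin> M" for v
  proof -
    define N where "N = {c *\<^sub>R v |c. c > 0} \<union> {m + c *\<^sub>R v |m c. m \<in> M \<and> c \<ge> 0}"
    have "blunt_cone N" unfolding N_def by (rule blunt_cone_extend[OF M'(1) v(2,3)])
    moreover have MN: "M \<subseteq> N"
    proof
      fix m assume "m \<in> M"
      then have "m + 0 *\<^sub>R v \<in> N" unfolding N_def by blast
      then show "m \<in> N" by simp
    qed
    moreover have "N \<subseteq> V" unfolding N_def using M'(3) v(1) by (auto intro!: subspace_add[OF V] subspace_scale[OF V])
    ultimately have "N \<in> \<A>" using M'(2) unfolding \<A>_def by auto
    then have "N = M" by (rule max[OF _ MN])
    moreover have "1 *\<^sub>R v \<in> N" unfolding N_def using zero_less_one by blast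
    ultimately show ?thesis by simp
  qed
  then show ?thesis using that[OF M'] by blast
qed

text \<open>
  A maximal cone \<open>M\<close> totally orders \<open>V\<close>, so \<open>f v = Inf {t. t *\<^sub>R w - v \<in> M}\<close> is not merely sublinear but
  linear. This stands in for the Hahn--Banach theorem.
\<close>

lemma order_unit_positive_functional:
  assumes V: "subspace V" and K: "blunt_cone K" "K \<subseteq> V" and w: "w \<in> K"
    and unit: "\<And>v. v \<in> V \<Longrightarrow> \<exists>s. s *\<^sub>R w + v \<in> K"
  obtains f where "linear_on_set V f" "f w = 1" "\<And>v. v \<in> K \<Longrightarrow> 0 \<le> f v"
proof -
  obtain M where M: "blunt_cone M" "K \<subseteq> M" "M \<subseteq> V"
    and tot: "\<And>v. v \<in> V \<Longrightarrow> v = 0 \<or> v \<in> M \<or> - v \<in> M"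
    using blunt_cone_total_extension[OF V K] by metis
  note D = blunt_coneD[OF M(1)]
  have wM: "w \<in> M" and wV: "w \<in> V" using w M(2,3) by auto
  \<comment> \<open>Along the line through \<open>w\<close> the order of \<open>M\<close> is that of
    the reals, which makes \<open>w\<close> a unit of measurement.\<close>
  have w_pos: "t *\<^sub>R w \<in> M \<longleftrightarrow> t > 0" for t
  proof
    assume t: "t *\<^sub>R w \<in> M"
    show "t > 0"
    proof (rule ccontr)
      assume "\<not> t > 0"
      then consider "t = 0" | "- t > 0" by linarith
      then show False
      proof cases
        case 1
        then show ?thesis using t D(1) by simp
      next
        case 2
        show ?thesis using D(2)[OF t D(3)[OF wM 2]] D(1) by simp
      qed
    qed
  qed (use D(3) wM in auto)
  \<comment> \<open>\<open>U v\<close> collects the multiples of \<open>w\<close> that lie strictly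
    above \<open>v\<close> in the order of \<open>M\<close>. It is closed upwards, and its infimum
    measures \<open>v\<close> in units of \<open>w\<close>.\<close>
  define U where "U v = {t. t *\<^sub>R w - v \<in> M}" for v
  define f where "f v = Inf (U v)" for v
  have up: "t' \<in> U v" if "t \<in> U v" "t < t'" for t t' v
  proof -
    have "(t *\<^sub>R w - v) + (t' - t) *\<^sub>R w \<in> M" using that w_pos D(2) unfolding U_def by simp
    then show ?thesis unfolding U_def by (simp add: algebra_simps)
  qed
  have ne: "U v \<noteq> {}" if "v \<in> V" for v
    using unit[of "- v"] subspace_neg[OF V that] M(2) unfolding U_def by auto
  have bdd: "bdd_below (U v)" if v: "v \<in> V" for v
  proof -
    obtain s where s: "s *\<^sub>R w + v \<in> M" using unit[OF v] M(2) by auto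
    have "- s \<le> t" if "t \<in> U v" for t
    proof -
      have "(t *\<^sub>R w - v) + (s *\<^sub>R w + v) \<in> M" using that s D(2) unfolding U_def by blast
      then have "(t + s) *\<^sub>R w \<in> M" by (simp add: algebra_simps)
      then show ?thesis using w_pos[of "t + s"] by simp
    qed
    then show ?thesis by (rule bdd_belowI)
  qed
  \<comment> \<open>Whether or not the infimum is attained, everything strictly above it lies in
    \<open>U v\<close>. Together with \<open>le'\<close> this trades inequalities between numbers
    for membership in \<open>M\<close>.\<close>
  have above: "t \<in> U v" if "v \<in> V" "f v < t" for t v
    using cInf_lessD[OF ne[OF that(1)]] that(2) up unfolding f_def by blast
  have le: "f v \<le> t" if "v \<in> V" "t \<in> U v" for v t
    unfolding f_def using cInf_lower[OF that(2) bdd[OF that(1)]] .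
  have le': "f v \<le> t" if v: "v \<in> V" and t: "\<And>t'. t < t' \<Longrightarrow> t' \<in> U v" for v t
    by (rule dense_ge) (rule le[OF v t])
  have eq: "f v = t" if v: "v \<in> V" and t: "\<And>t'. t' \<in> U v \<longleftrightarrow> t < t'" for v t
  proof (rule antisym[OF le'[OF v]])
    show "t \<le> f v" by (rule dense_ge) (use above[OF v] t in force)
  qed (simp add: t)
  have f0: "f 0 = 0" by (rule eq) (simp_all add: subspace_0[OF V] U_def w_pos)
  have fw: "f w = 1"
  proof (rule eq[OF wV])
    show "t' \<in> U w \<longleftrightarrow> 1 < t'" for t'
      using w_pos[of "t' - 1"] unfolding U_def by (simp add: algebra_simps)
  qed
  have subadd: "f (x + y) \<le> f x + f y" if xy: "x \<in> V" "y \<in> V" for x y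
  proof (rule le'[OF subspace_add[OF V xy]])
    fix t assume t: "f x + f y < t"
    define d where "d = (t - f x - f y) / 2"
    have "f x + d \<in> U x" "f y + d \<in> U y"
      using above[of x "f x + d"] above[of y "f y + d"] xy t unfolding d_def by auto
    then have "((f x + d) *\<^sub>R w - x) + ((f y + d) *\<^sub>R w - y) \<in> M" unfolding U_def using D(2) by blast
    moreover have "(p *\<^sub>R w - x) + (q *\<^sub>R w - y) = (p + q) *\<^sub>R w - (x + y)" for p q
      by (simp add: algebra_simps)
    moreover have "(f x + d) + (f y + d) = t" unfolding d_def by (simp add: field_simps)
    ultimately show "t \<in> U (x + y)" unfolding U_def by simp
  qed
  \<comment> \<open>This is where totality of \<open>M\<close> enters: a multiple of
    \<open>w\<close> that is not strictly above \<open>x\<close> equals \<open>x\<close> or is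
    strictly below it. It turns subadditivity into additivity.\<close>
  have neg: "f (- x) = - f x" if x: "x \<in> V" for x
  proof (rule antisym)
    have x': "- x \<in> V" by (rule subspace_neg[OF V x])
    show "- f x \<le> f (- x)" using subadd[OF x x'] f0 by simp
    show "f (- x) \<le> - f x"
    proof (rule le'[OF x'])
      fix s assume s: "- f x < s"
      \<comment> \<open>The midpoint of \<open>- s\<close> and \<open>f x\<close>: it lies below
        \<open>f x\<close>, hence outside \<open>U x\<close>, while \<open>s + t\<close> stays
        positive.\<close>
      define t where "t = (f x - s) / 2"
      have "t \<notin> U x" using le[OF x, of t] s unfolding t_def by auto
      then have "x - t *\<^sub>R w = 0 \<or> x - t *\<^sub>R w \<in> M"
        using tot[of "x - t *\<^sub>R w"] V x wV unfolding U_def by (auto simp: subspace_diff subspace_scale)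
      moreover have "(s + t) *\<^sub>R w \<in> M" using w_pos s unfolding t_def by (simp add: field_simps)
      ultimately have "(x - t *\<^sub>R w) + (s + t) *\<^sub>R w \<in> M" using D(2)[of "x - t *\<^sub>R w"] by auto
      then show "s \<in> U (- x)" unfolding U_def by (simp add: algebra_simps)
    qed
  qed
  have add: "f (x + y) = f x + f y" if xy: "x \<in> V" "y \<in> V" for x y
    using subadd[OF xy] subadd[OF subspace_add[OF V xy] subspace_neg[OF V xy(2)]] neg[OF xy(2)] by simp
  have scale_le: "f (c *\<^sub>R x) \<le> c * f x" if x: "x \<in> V" and c: "c > 0" for c x
  proof (rule le'[OF subspace_scale[OF V x]])
    fix t assume "c * f x < t"
    then have "t / c \<in> U x" using above[OF x, of "t / c"] c by (simp add: field_simps)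
    then have "c *\<^sub>R ((t / c) *\<^sub>R w - x) \<in> M" unfolding U_def using D(3) c by blast
    then show "t \<in> U (c *\<^sub>R x)" using c unfolding U_def by (simp add: scaleR_diff_right)
  qed
  have scale_pos: "f (c *\<^sub>R x) = c * f x" if x: "x \<in> V" and c: "c > 0" for c x
  proof (rule antisym[OF scale_le[OF x c]])
    \<comment> \<open>The reverse inequality is the one already proved, for the factor
      \<open>1/c\<close> and the vector \<open>c *\<^sub>R x\<close>.\<close>
    have "f ((1/c) *\<^sub>R (c *\<^sub>R x)) \<le> (1/c) * f (c *\<^sub>R x)"
      by (rule scale_le) (use V x c in \<open>auto simp: subspace_scale\<close>)
    then show "c * f x \<le> f (c *\<^sub>R x)" using c by (simp add: field_simps)
  qed
  have scale: "f (c *\<^sub>R x) = c * f x" if x: "x \<in> V" for c x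
  proof -
    consider "c > 0" | "c = 0" | "- c > 0" by linarith
    then show ?thesis
    proof cases
      case 3
      then show ?thesis using scale_pos[OF x 3] neg[OF subspace_scale[OF V x], of "c"] by simp
    qed (simp_all add: scale_pos x f0)
  qed
  have "0 \<le> f v" if v: "v \<in> K" for v
  proof -
    have vV: "v \<in> V" using v K by auto
    have "f (- v) \<le> 0"
    proof (rule le'[OF subspace_neg[OF V vV]])
      fix t :: real assume "0 < t"
      then show "t \<in> U (- v)" using w_pos D(2) v M(2) unfolding U_def by auto
    qed
    then show ?thesis using neg[OF vV] by simp
  qed
  then show ?thesis using that[of f] add scale fw unfolding linear_on_set_def by blast
qed

text \<open>Let \<open>K\<close> be the cone generated by the differences \<open>z - x\<close> with
  \<open>z\<close> in \<open>B\<close> and \<open>x\<close> in \<open>C\<close>. The ball around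
  \<open>a\<close> makes \<open>b - a\<close> an order unit for \<open>K\<close>, so a positive
  functional normalised there exists, and positivity on \<open>K\<close> is the separation. The norm
  bound comes from the ball of radius \<open>r\<close> around \<open>b - a\<close>, which lies in
  \<open>K\<close>.\<close>

lemma normed_separation:
  fixes n :: "'a::real_vector \<Rightarrow> real"
  assumes V: "subspace V"
    and n0: "\<And>x. x \<in> V \<Longrightarrow> 0 \<le> n x" "\<And>x. x \<in> V \<Longrightarrow> n x = 0 \<longleftrightarrow> x = 0"
    and n_scale: "\<And>c x. x \<in> V \<Longrightarrow> n (c *\<^sub>R x) = \<bar>c\<bar> * n x"
    and C: "convex C" "C \<subseteq> V" and B: "convex B" "B \<subseteq> V" and disj: "C \<inter> B = {}"
    and a: "a \<in> V" and b: "b \<in> B" and r: "r > 0"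
    and ball: "\<And>x. x \<in> V \<Longrightarrow> n (x - a) \<le> r \<Longrightarrow> x \<in> C"
  obtains f \<alpha> where "linear_on_set V f" "f (b - a) = 1"
    "\<And>v. v \<in> V \<Longrightarrow> \<bar>f v\<bar> \<le> n v / r"
    "\<And>x. x \<in> C \<Longrightarrow> f x \<le> \<alpha>" "\<And>z. z \<in> B \<Longrightarrow> \<alpha> \<le> f z"
proof -
  define K where "K = {s *\<^sub>R (z - x) |s z x. s > 0 \<and> z \<in> B \<and> x \<in> C}"
  have bV: "b \<in> V" using b B by auto
  have KI: "s *\<^sub>R (z - x) \<in> K" if "s > 0" "z \<in> B" "x \<in> C" for s z x using that unfolding K_def by blast
  have KI': "z - x \<in> K" if "z \<in> B" "x \<in> C" for z x using KI[of 1, OF _ that] by simp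
  have KV: "K \<subseteq> V" unfolding K_def using B(2) C(2) by (auto intro!: subspace_scale[OF V] subspace_diff[OF V])
  have "0 \<notin> K" unfolding K_def using disj by auto
  moreover have "p + q \<in> K" if pq: "p \<in> K" "q \<in> K" for p q
  proof -
    obtain s z x where p: "s > 0" "z \<in> B" "x \<in> C" "p = s *\<^sub>R (z - x)" using pq(1) unfolding K_def by blast
    obtain t z' x' where q: "t > 0" "z' \<in> B" "x' \<in> C" "q = t *\<^sub>R (z' - x')" using pq(2) unfolding K_def by blast
    \<comment> \<open>Two elements of the cone are added by pulling out the total weight
      \<open>s + t\<close>; what remains is a convex combination inside \<open>B\<close> minus one
      inside \<open>C\<close>.\<close>
    have st: "s/(s+t) + t/(s+t) = 1" using p(1) q(1) by (simp add: add_divide_distrib[symmetric])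
    have "(s/(s+t)) *\<^sub>R z + (t/(s+t)) *\<^sub>R z' \<in> B" "(s/(s+t)) *\<^sub>R x + (t/(s+t)) *\<^sub>R x' \<in> C"
      by (rule convexD; use B C p q st in \<open>auto\<close>)+
    from KI[OF _ this, of "s + t"]
    have "(s+t) *\<^sub>R (((s/(s+t)) *\<^sub>R z + (t/(s+t)) *\<^sub>R z') - ((s/(s+t)) *\<^sub>R x + (t/(s+t)) *\<^sub>R x')) \<in> K"
      using p q by simp
    also have "(s+t) *\<^sub>R (((s/(s+t)) *\<^sub>R z + (t/(s+t)) *\<^sub>R z') - ((s/(s+t)) *\<^sub>R x + (t/(s+t)) *\<^sub>R x'))
        = p + q"
      using p q by (simp add: scaleR_diff_right scaleR_add_right)
    finally show ?thesis .
  qed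
  moreover have "c *\<^sub>R p \<in> K" if p: "p \<in> K" "c > 0" for c p
  proof -
    obtain s z x where p': "s > 0" "z \<in> B" "x \<in> C" "p = s *\<^sub>R (z - x)" using p(1) unfolding K_def by blast
    then show ?thesis using KI[of "c * s" z x] p by simp
  qed
  ultimately have K: "blunt_cone K" unfolding blunt_cone_def by blast
  have near: "(b - a) + v \<in> K" if v: "v \<in> V" "n v \<le> r" for v
  proof -
    have "n ((a - v) - a) \<le> r" using n_scale[OF v(1), of "-1"] v(2) by simp
    then have "a - v \<in> C" using ball[of "a - v"] V a v by (auto simp: subspace_diff)
    then show ?thesis using KI'[OF b, of "a - v"] by (simp add: algebra_simps)
  qed
  have aC: "a \<in> C" using ball[OF a] n0(2)[OF subspace_0[OF V]] r by simp
  have "b - a \<in> K" by (rule KI'[OF b aC])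
  moreover have "\<exists>s. s *\<^sub>R (b - a) + v \<in> K" if v: "v \<in> V" for v
  proof -
    \<comment> \<open>Dividing \<open>v\<close> by \<open>s\<close> brings it into the ball of
      radius \<open>r\<close>; the summand 1 keeps \<open>s\<close> positive when \<open>v\<close>
      is 0.\<close>
    define s where "s = n v / r + 1"
    have s: "s > 0" using n0(1)[OF v] r unfolding s_def by (simp add: add_nonneg_pos)
    have "n ((1/s) *\<^sub>R v) \<le> r" using n_scale[OF v] s r n0(1)[OF v] unfolding s_def
      by (simp add: field_simps)
    then have "(b - a) + (1/s) *\<^sub>R v \<in> K" using near V v by (auto simp: subspace_scale)
    then have "s *\<^sub>R ((b - a) + (1/s) *\<^sub>R v) \<in> K" using K s by (auto simp: blunt_cone_def)
    then have "s *\<^sub>R (b - a) + v \<in> K" using s by (simp add: scaleR_add_right)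
    then show ?thesis ..
  qed
  ultimately obtain f where f: "linear_on_set V f" "f (b - a) = 1" "\<And>v. v \<in> K \<Longrightarrow> 0 \<le> f v"
    using order_unit_positive_functional[OF V K KV] by metis
  have add: "f (x + y) = f x + f y" if "x \<in> V" "y \<in> V" for x y
    using f(1) that by (auto simp: linear_on_set_def)
  have sc: "f (c *\<^sub>R x) = c * f x" if "x \<in> V" for c x
    using f(1) that by (auto simp: linear_on_set_def)
  have "f x \<le> f z" if "x \<in> C" "z \<in> B" for x z
  proof -
    have "0 \<le> f (z - x)" using f(3) KI' that by blast
    moreover have "f (x + (z - x)) = f x + f (z - x)"
      by (rule add) (use that subspace_diff[OF V] B(2) C(2) in blast)+
    ultimately show ?thesis by simp
  qed
  then have "f x \<le> Sup (f ` C)" "Sup (f ` C) \<le> f z" if "x \<in> C" "z \<in> B" for x z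
    using that by (auto intro!: cSup_upper cSup_least bdd_aboveI2)
  then have sup: "\<And>x. x \<in> C \<Longrightarrow> f x \<le> Sup (f ` C)" "\<And>z. z \<in> B \<Longrightarrow> Sup (f ` C) \<le> f z"
    using b aC by blast+
  have lower: "- f v \<le> n v / r" if v: "v \<in> V" for v
  proof (cases "v = 0")
    case True
    then show ?thesis using sc[OF v, of 0] n0(2)[OF v] by simp
  next
    case False
    then have nv: "n v > 0" using n0(1)[OF v] n0(2)[OF v] by simp
    \<comment> \<open>\<open>v\<close> rescaled to norm \<open>r\<close>. Positivity at
      \<open>(b - a) + ?u\<close> then bounds \<open>- f v\<close>, and the same bound for
      \<open>- v\<close> completes the estimate of the absolute value.\<close>
    let ?u = "(r / n v) *\<^sub>R v"
    have uV: "?u \<in> V" by (rule subspace_scale[OF V v])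
    have "n ?u \<le> r" using n_scale[OF v] nv r by simp
    then have "0 \<le> f ((b - a) + ?u)" using f(3) near[OF uV] by blast
    also have "\<dots> = 1 + (r / n v) * f v"
      using add[of "b - a" ?u] uV V bV a f(2) sc[OF v] by (simp add: subspace_diff)
    finally show ?thesis using nv r by (simp add: field_simps)
  qed
  have "\<bar>f v\<bar> \<le> n v / r" if v: "v \<in> V" for v
    using lower[OF v] lower[OF subspace_neg[OF V v]] sc[OF v, of "-1"] n_scale[OF v, of "-1"] by auto
  then show ?thesis using that[OF f(1,2)] sup by blast
qed

section \<open>Moderate and negligible nets\<close>

abbreviation small :: "real filter" where
  "small \<equiv> at 0 within idx"

text \<open>The Landau constant is omitted because a further power of the gauge absorbs it.
  Extensionality is omitted too, so that nets can be added and scaled as plain functions;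
  \<open>cls\<close> restores it by restricting its argument.\<close>

definition mod_net :: "(real \<Rightarrow> real) \<Rightarrow> 'a::real_vector nfam \<Rightarrow> (real \<Rightarrow> 'a) \<Rightarrow> bool" where
  "mod_net \<rho> E u \<longleftrightarrow> (\<forall>\<epsilon>\<in>idx. u \<epsilon> \<in> Car E \<epsilon>)
     \<and> (\<exists>N. \<forall>\<^sub>F \<epsilon> in small. nm E \<epsilon> (u \<epsilon>) \<le> inverse (\<rho> \<epsilon> ^ N))"

definition negl_net :: "(real \<Rightarrow> real) \<Rightarrow> 'a::real_vector nfam \<Rightarrow> (real \<Rightarrow> 'a) \<Rightarrow> bool" where
  "negl_net \<rho> E u \<longleftrightarrow> (\<forall>\<epsilon>\<in>idx. u \<epsilon> \<in> Car E \<epsilon>)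
     \<and> (\<forall>N. \<forall>\<^sub>F \<epsilon> in small. nm E \<epsilon> (u \<epsilon>) \<le> \<rho> \<epsilon> ^ N)"

lemma Rfam_simps [simp]: "Car Rfam \<epsilon> = UNIV" "nm Rfam \<epsilon> x = \<bar>x\<bar>"
  by (simp_all add: Rfam_def)

lemma normed_family_Rfam [simp]: "normed_family Rfam"
  unfolding normed_family_def by (simp add: abs_triangle_ineq abs_mult)

lemma normed_familyD:
  assumes E: "normed_family E" and e: "\<epsilon> \<in> idx"
  shows "subspace (Car E \<epsilon>)" "0 \<in> Car E \<epsilon>"
    and "x \<in> Car E \<epsilon> \<Longrightarrow> y \<in> Car E \<epsilon> \<Longrightarrow> x + y \<in> Car E \<epsilon>"
    and "x \<in> Car E \<epsilon> \<Longrightarrow> y \<in> Car E \<epsilon> \<Longrightarrow> x - y \<in> Car E \<epsilon>"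
    and "x \<in> Car E \<epsilon> \<Longrightarrow> c *\<^sub>R x \<in> Car E \<epsilon>"
    and "x \<in> Car E \<epsilon> \<Longrightarrow> 0 \<le> nm E \<epsilon> x"
    and "x \<in> Car E \<epsilon> \<Longrightarrow> nm E \<epsilon> x = 0 \<longleftrightarrow> x = 0"
    and "nm E \<epsilon> 0 = 0"
    and "x \<in> Car E \<epsilon> \<Longrightarrow> y \<in> Car E \<epsilon> \<Longrightarrow> nm E \<epsilon> (x + y) \<le> nm E \<epsilon> x + nm E \<epsilon> y"
    and "x \<in> Car E \<epsilon> \<Longrightarrow> nm E \<epsilon> (c *\<^sub>R x) = \<bar>c\<bar> * nm E \<epsilon> x"
    and "x \<in> Car E \<epsilon> \<Longrightarrow> y \<in> Car E \<epsilon> \<Longrightarrow> nm E \<epsilon> (x - y) = nm E \<epsilon> (y - x)"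
    and "x \<in> Car E \<epsilon> \<Longrightarrow> y \<in> Car E \<epsilon> \<Longrightarrow> nm E \<epsilon> (x - y) \<le> nm E \<epsilon> x + nm E \<epsilon> y"
proof -
  show V: "subspace (Car E \<epsilon>)" using E e unfolding normed_family_def by blast
  note mem = subspace_0[OF V] subspace_add[OF V] subspace_diff[OF V] subspace_scale[OF V]
  show "0 \<in> Car E \<epsilon>"
    "x \<in> Car E \<epsilon> \<Longrightarrow> y \<in> Car E \<epsilon> \<Longrightarrow> x + y \<in> Car E \<epsilon>"
    "x \<in> Car E \<epsilon> \<Longrightarrow> y \<in> Car E \<epsilon> \<Longrightarrow> x - y \<in> Car E \<epsilon>"
    "x \<in> Car E \<epsilon> \<Longrightarrow> c *\<^sub>R x \<in> Car E \<epsilon>"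
    by (simp_all add: mem)
  show "x \<in> Car E \<epsilon> \<Longrightarrow> 0 \<le> nm E \<epsilon> x"
    "x \<in> Car E \<epsilon> \<Longrightarrow> nm E \<epsilon> x = 0 \<longleftrightarrow> x = 0"
    "nm E \<epsilon> 0 = 0"
    using E e mem(1) unfolding normed_family_def by blast+
  show tri: "nm E \<epsilon> (x + y) \<le> nm E \<epsilon> x + nm E \<epsilon> y" if "x \<in> Car E \<epsilon>" "y \<in> Car E \<epsilon>" for x y
    using E e that unfolding normed_family_def by blast
  show scale: "nm E \<epsilon> (c *\<^sub>R x) = \<bar>c\<bar> * nm E \<epsilon> x" if "x \<in> Car E \<epsilon>" for c x
    using E e that unfolding normed_family_def by blast
  show "nm E \<epsilon> (x - y) = nm E \<epsilon> (y - x)" if "x \<in> Car E \<epsilon>" "y \<in> Car E \<epsilon>" for x y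
    using scale[OF mem(3)[OF that], of "-1"] by simp
  show "nm E \<epsilon> (x - y) \<le> nm E \<epsilon> x + nm E \<epsilon> y" if "x \<in> Car E \<epsilon>" "y \<in> Car E \<epsilon>" for x y
    using tri[OF that(1) mem(4)[OF that(2), of "-1"]] scale[OF that(2), of "-1"] by simp
qed

lemma ev_idx: "\<forall>\<^sub>F \<epsilon> in small. \<epsilon> \<in> idx"
  by (simp add: eventually_at_filter)

lemma restrict_mod_net: "mod_net \<rho> E (restrict u idx) = mod_net \<rho> E u"
proof -
  have "(\<forall>\<^sub>F \<epsilon> in small. nm E \<epsilon> (restrict u idx \<epsilon>) \<le> inverse (\<rho> \<epsilon> ^ N)) \<longleftrightarrow>
    (\<forall>\<^sub>F \<epsilon> in small. nm E \<epsilon> (u \<epsilon>) \<le> inverse (\<rho> \<epsilon> ^ N))" for N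
    by (rule eventually_cong[OF ev_idx]) simp
  then show ?thesis unfolding mod_net_def by simp
qed

lemma negl_net_cong:
  assumes "\<And>\<epsilon>. \<epsilon> \<in> idx \<Longrightarrow> u \<epsilon> = v \<epsilon>"
  shows "negl_net \<rho> E u = negl_net \<rho> E v"
proof -
  have "(\<forall>\<^sub>F \<epsilon> in small. nm E \<epsilon> (u \<epsilon>) \<le> \<rho> \<epsilon> ^ N) \<longleftrightarrow> (\<forall>\<^sub>F \<epsilon> in small. nm E \<epsilon> (v \<epsilon>) \<le> \<rho> \<epsilon> ^ N)" for N
    by (rule eventually_cong[OF ev_idx]) (use assms in simp)
  then show ?thesis unfolding negl_net_def using assms by simp
qed

lemma restrict_negl_net: "negl_net \<rho> E (restrict u idx) = negl_net \<rho> E u"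
  by (rule negl_net_cong) simp

lemma mod_net_Car: "mod_net \<rho> E u \<Longrightarrow> \<epsilon> \<in> idx \<Longrightarrow> u \<epsilon> \<in> Car E \<epsilon>"
  and negl_net_Car: "negl_net \<rho> E u \<Longrightarrow> \<epsilon> \<in> idx \<Longrightarrow> u \<epsilon> \<in> Car E \<epsilon>"
  by (auto simp: mod_net_def negl_net_def)

lemma cls_cong: "(\<And>\<epsilon>. \<epsilon> \<in> idx \<Longrightarrow> u \<epsilon> = v \<epsilon>) \<Longrightarrow> cls \<rho> F idx u = cls \<rho> F idx v"
  unfolding cls_def by (metis restrict_ext)

section \<open>Estimates of nets by powers of the gauge\<close>

locale gauge =
  fixes \<rho> :: "real \<Rightarrow> real"
  assumes gauge: "gauge_net \<rho>"
begin

lemma rho: "\<epsilon> \<in> idx \<Longrightarrow> 0 < \<rho> \<epsilon>" "\<epsilon> \<in> idx \<Longrightarrow> \<rho> \<epsilon> \<le> 1"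
  using gauge unfolding gauge_net_def by (auto simp: Pi_iff)

lemma ev_rho_le: "0 < c \<Longrightarrow> \<forall>\<^sub>F \<epsilon> in small. \<rho> \<epsilon> \<le> c"
  using gauge unfolding gauge_net_def by (auto dest!: order_tendstoD(2) elim: eventually_mono)

lemma rho_pow_mono: "\<epsilon> \<in> idx \<Longrightarrow> M \<le> N \<Longrightarrow> \<rho> \<epsilon> ^ N \<le> \<rho> \<epsilon> ^ M"
  using rho[of \<epsilon>] by (intro power_decreasing) auto

lemma rho_inv_mono: "\<epsilon> \<in> idx \<Longrightarrow> M \<le> N \<Longrightarrow> inverse (\<rho> \<epsilon> ^ M) \<le> inverse (\<rho> \<epsilon> ^ N)"
  using rho_pow_mono[of \<epsilon> M N] rho[of \<epsilon>] by (intro le_imp_inverse_le) auto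

text \<open>As the gauge tends to 0, a constant factor is paid for by one extra power of it. This is
  how constants disappear from the later estimates.\<close>

lemma ev_absorb:
  assumes "0 < c"
  shows "\<forall>\<^sub>F \<epsilon> in small. c * \<rho> \<epsilon> ^ Suc N \<le> \<rho> \<epsilon> ^ N"
    and "\<forall>\<^sub>F \<epsilon> in small. c * inverse (\<rho> \<epsilon> ^ N) \<le> inverse (\<rho> \<epsilon> ^ Suc N)"
proof -
  have "\<forall>\<^sub>F \<epsilon> in small. \<rho> \<epsilon> \<le> inverse c" by (rule ev_rho_le) (use assms in simp)
  with ev_idx have ev: "\<forall>\<^sub>F \<epsilon> in small. 0 < \<rho> \<epsilon> \<and> c * \<rho> \<epsilon> \<le> 1"
    by eventually_elim (use assms rho in \<open>auto simp: field_simps\<close>)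
  from ev show "\<forall>\<^sub>F \<epsilon> in small. c * \<rho> \<epsilon> ^ Suc N \<le> \<rho> \<epsilon> ^ N"
  proof eventually_elim
    case (elim \<epsilon>)
    then have "(c * \<rho> \<epsilon>) * \<rho> \<epsilon> ^ N \<le> 1 * \<rho> \<epsilon> ^ N" by (intro mult_right_mono) auto
    then show ?case by simp
  qed
  from ev show "\<forall>\<^sub>F \<epsilon> in small. c * inverse (\<rho> \<epsilon> ^ N) \<le> inverse (\<rho> \<epsilon> ^ Suc N)"
    by eventually_elim (simp add: field_simps)
qed

lemma moderate_iff:
  assumes E: "normed_family E"
  shows "u \<in> moderate \<rho> E idx \<longleftrightarrow> u \<in> extensional idx \<and> mod_net \<rho> E u"
proof -
  have "(\<exists>N. (\<lambda>\<epsilon>. nm E \<epsilon> (u \<epsilon>)) \<in> O[small](\<lambda>\<epsilon>. inverse (\<rho> \<epsilon> ^ N))) \<longleftrightarrow>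
    (\<exists>N. \<forall>\<^sub>F \<epsilon> in small. nm E \<epsilon> (u \<epsilon>) \<le> inverse (\<rho> \<epsilon> ^ N))"
    if Car: "\<forall>\<epsilon>\<in>idx. u \<epsilon> \<in> Car E \<epsilon>"
  proof
    assume "\<exists>N. (\<lambda>\<epsilon>. nm E \<epsilon> (u \<epsilon>)) \<in> O[small](\<lambda>\<epsilon>. inverse (\<rho> \<epsilon> ^ N))"
    then obtain N c where c: "c > 0"
      and ev: "\<forall>\<^sub>F \<epsilon> in small. norm (nm E \<epsilon> (u \<epsilon>)) \<le> c * norm (inverse (\<rho> \<epsilon> ^ N))"
      by (auto elim!: landau_o.bigE)
    have "\<forall>\<^sub>F \<epsilon> in small. nm E \<epsilon> (u \<epsilon>) \<le> inverse (\<rho> \<epsilon> ^ Suc N)"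
      using ev ev_absorb(2)[OF c, of N] ev_idx
    proof eventually_elim
      case (elim \<epsilon>)
      have "norm (inverse (\<rho> \<epsilon> ^ N)) = inverse (\<rho> \<epsilon> ^ N)" using rho(1)[OF elim(3)] by simp
      then show ?case using elim(1,2) by simp
    qed
    then show "\<exists>N. \<forall>\<^sub>F \<epsilon> in small. nm E \<epsilon> (u \<epsilon>) \<le> inverse (\<rho> \<epsilon> ^ N)" ..
  next
    assume "\<exists>N. \<forall>\<^sub>F \<epsilon> in small. nm E \<epsilon> (u \<epsilon>) \<le> inverse (\<rho> \<epsilon> ^ N)"
    then obtain N where ev: "\<forall>\<^sub>F \<epsilon> in small. nm E \<epsilon> (u \<epsilon>) \<le> inverse (\<rho> \<epsilon> ^ N)" ..
    have "\<forall>\<^sub>F \<epsilon> in small. norm (nm E \<epsilon> (u \<epsilon>)) \<le> 1 * norm (inverse (\<rho> \<epsilon> ^ N))"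
      using ev ev_idx
    proof eventually_elim
      case (elim \<epsilon>)
      have "0 \<le> nm E \<epsilon> (u \<epsilon>)" "0 < \<rho> \<epsilon> ^ N"
        using Car normed_familyD(6)[OF E elim(2)] rho(1)[OF elim(2)] elim(2) by auto
      then show ?case using elim(1) by simp
    qed
    then show "\<exists>N. (\<lambda>\<epsilon>. nm E \<epsilon> (u \<epsilon>)) \<in> O[small](\<lambda>\<epsilon>. inverse (\<rho> \<epsilon> ^ N))"
      by (blast intro: bigoI)
  qed
  then show ?thesis unfolding moderate_def mod_net_def PiE_def by blast
qed

lemma negligible_iff:
  assumes E: "normed_family E"
  shows "u \<in> negligible \<rho> E idx \<longleftrightarrow> u \<in> extensional idx \<and> negl_net \<rho> E u"
proof -
  have "(\<forall>N. (\<lambda>\<epsilon>. nm E \<epsilon> (u \<epsilon>)) \<in> O[small](\<lambda>\<epsilon>. \<rho> \<epsilon> ^ N)) \<longleftrightarrow>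
    (\<forall>N. \<forall>\<^sub>F \<epsilon> in small. nm E \<epsilon> (u \<epsilon>) \<le> \<rho> \<epsilon> ^ N)"
    if Car: "\<forall>\<epsilon>\<in>idx. u \<epsilon> \<in> Car E \<epsilon>"
  proof (intro iffI allI)
    fix N
    assume "\<forall>N. (\<lambda>\<epsilon>. nm E \<epsilon> (u \<epsilon>)) \<in> O[small](\<lambda>\<epsilon>. \<rho> \<epsilon> ^ N)"
    then have "(\<lambda>\<epsilon>. nm E \<epsilon> (u \<epsilon>)) \<in> O[small](\<lambda>\<epsilon>. \<rho> \<epsilon> ^ Suc N)" ..
    then obtain c where c: "c > 0"
      and ev: "\<forall>\<^sub>F \<epsilon> in small. norm (nm E \<epsilon> (u \<epsilon>)) \<le> c * norm (\<rho> \<epsilon> ^ Suc N)"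
      by (rule landau_o.bigE)
    show "\<forall>\<^sub>F \<epsilon> in small. nm E \<epsilon> (u \<epsilon>) \<le> \<rho> \<epsilon> ^ N"
      using ev ev_absorb(1)[OF c, of N] ev_idx
    proof eventually_elim
      case (elim \<epsilon>)
      have "norm (\<rho> \<epsilon> ^ Suc N) = \<rho> \<epsilon> ^ Suc N" using rho(1)[OF elim(3)] by simp
      then show ?case using elim(1,2) by simp
    qed
  next
    fix N
    assume "\<forall>N. \<forall>\<^sub>F \<epsilon> in small. nm E \<epsilon> (u \<epsilon>) \<le> \<rho> \<epsilon> ^ N"
    then have ev: "\<forall>\<^sub>F \<epsilon> in small. nm E \<epsilon> (u \<epsilon>) \<le> \<rho> \<epsilon> ^ N" ..
    have "\<forall>\<^sub>F \<epsilon> in small. norm (nm E \<epsilon> (u \<epsilon>)) \<le> 1 * norm (\<rho> \<epsilon> ^ N)"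
      using ev ev_idx
    proof eventually_elim
      case (elim \<epsilon>)
      have "0 \<le> nm E \<epsilon> (u \<epsilon>)" "0 < \<rho> \<epsilon> ^ N"
        using Car normed_familyD(6)[OF E elim(2)] rho(1)[OF elim(2)] elim(2) by auto
      then show ?case using elim(1) by simp
    qed
    then show "(\<lambda>\<epsilon>. nm E \<epsilon> (u \<epsilon>)) \<in> O[small](\<lambda>\<epsilon>. \<rho> \<epsilon> ^ N)" by (rule bigoI)
  qed
  then show ?thesis unfolding negligible_def negl_net_def PiE_def by blast
qed

text \<open>The constant may depend on the exponent, since the bound for the next exponent absorbs
  it.\<close>

lemma negl_netI:
  assumes "\<And>\<epsilon>. \<epsilon> \<in> idx \<Longrightarrow> u \<epsilon> \<in> Car E \<epsilon>"
    and "\<And>N. \<exists>c>0. \<forall>\<^sub>F \<epsilon> in small. nm E \<epsilon> (u \<epsilon>) \<le> c * \<rho> \<epsilon> ^ N"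
  shows "negl_net \<rho> E u"
  unfolding negl_net_def
proof (intro conjI allI ballI)
  fix N
  obtain c where c: "c > 0" and ev: "\<forall>\<^sub>F \<epsilon> in small. nm E \<epsilon> (u \<epsilon>) \<le> c * \<rho> \<epsilon> ^ Suc N"
    using assms(2) by blast
  show "\<forall>\<^sub>F \<epsilon> in small. nm E \<epsilon> (u \<epsilon>) \<le> \<rho> \<epsilon> ^ N"
    using ev ev_absorb(1)[OF c, of N] by eventually_elim simp
qed (use assms in auto)

lemma negl_netD: "negl_net \<rho> E u \<Longrightarrow> \<forall>\<^sub>F \<epsilon> in small. nm E \<epsilon> (u \<epsilon>) \<le> \<rho> \<epsilon> ^ N"
  by (simp add: negl_net_def)

lemma negl_net_add:
  assumes E: "normed_family E" and u: "negl_net \<rho> E u" and v: "negl_net \<rho> E v"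
  shows "negl_net \<rho> E (\<lambda>\<epsilon>. u \<epsilon> + v \<epsilon>)"
proof (rule negl_netI)
  show "u \<epsilon> + v \<epsilon> \<in> Car E \<epsilon>" if "\<epsilon> \<in> idx" for \<epsilon>
    using normed_familyD(3)[OF E that] that u v by (simp add: negl_net_def)
  fix N
  have "\<forall>\<^sub>F \<epsilon> in small. nm E \<epsilon> (u \<epsilon> + v \<epsilon>) \<le> 2 * \<rho> \<epsilon> ^ N"
    using negl_netD[OF u, of N] negl_netD[OF v, of N] ev_idx
  proof eventually_elim
    case (elim \<epsilon>)
    then show ?case using normed_familyD(9)[OF E elim(3) negl_net_Car[OF u elim(3)] negl_net_Car[OF v elim(3)]] by linarith
  qed
  then show "\<exists>c>0. \<forall>\<^sub>F \<epsilon> in small. nm E \<epsilon> (u \<epsilon> + v \<epsilon>) \<le> c * \<rho> \<epsilon> ^ N"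
    by (intro exI[of _ 2]) simp
qed

lemma mod_netD:
  assumes "mod_net \<rho> E u"
  obtains N where "\<forall>\<^sub>F \<epsilon> in small. nm E \<epsilon> (u \<epsilon>) \<le> inverse (\<rho> \<epsilon> ^ N)"
  using assms by (auto simp: mod_net_def)

lemma mod_netI:
  assumes "\<And>\<epsilon>. \<epsilon> \<in> idx \<Longrightarrow> u \<epsilon> \<in> Car E \<epsilon>"
    and "\<forall>\<^sub>F \<epsilon> in small. nm E \<epsilon> (u \<epsilon>) \<le> inverse (\<rho> \<epsilon> ^ N)"
  shows "mod_net \<rho> E u"
  using assms by (auto simp: mod_net_def)

lemma mod_net_add:
  assumes E: "normed_family E" and u: "mod_net \<rho> E u" and v: "mod_net \<rho> E v"
  shows "mod_net \<rho> E (\<lambda>\<epsilon>. u \<epsilon> + v \<epsilon>)"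
proof -
  obtain M where M: "\<forall>\<^sub>F \<epsilon> in small. nm E \<epsilon> (u \<epsilon>) \<le> inverse (\<rho> \<epsilon> ^ M)"
    using mod_netD[OF u] .
  obtain N where N: "\<forall>\<^sub>F \<epsilon> in small. nm E \<epsilon> (v \<epsilon>) \<le> inverse (\<rho> \<epsilon> ^ N)"
    using mod_netD[OF v] .
  have "\<forall>\<^sub>F \<epsilon> in small. nm E \<epsilon> (u \<epsilon> + v \<epsilon>) \<le> inverse (\<rho> \<epsilon> ^ Suc (max M N))"
    using M N ev_absorb(2)[of 2 "max M N", OF zero_less_numeral] ev_idx
  proof (eventually_elim)
    case (elim \<epsilon>)
    show ?case
      using normed_familyD(9)[OF E elim(4) mod_net_Car[OF u elim(4)] mod_net_Car[OF v elim(4)]]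
        rho_inv_mono[OF elim(4), of M "max M N"] rho_inv_mono[OF elim(4), of N "max M N"] elim(1-3)
      by linarith
  qed
  then show ?thesis
    by (rule mod_netI[rotated]) (use normed_familyD(3)[OF E] mod_net_Car u v in blast)
qed

lemma mod_net_scale:
  assumes E: "normed_family E" and a: "mod_net \<rho> Rfam a" and u: "mod_net \<rho> E u"
  shows "mod_net \<rho> E (\<lambda>\<epsilon>. a \<epsilon> *\<^sub>R u \<epsilon>)"
proof -
  obtain M where M: "\<forall>\<^sub>F \<epsilon> in small. nm Rfam \<epsilon> (a \<epsilon>) \<le> inverse (\<rho> \<epsilon> ^ M)"
    using mod_netD[OF a] .
  obtain N where N: "\<forall>\<^sub>F \<epsilon> in small. nm E \<epsilon> (u \<epsilon>) \<le> inverse (\<rho> \<epsilon> ^ N)"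
    using mod_netD[OF u] .
  have "\<forall>\<^sub>F \<epsilon> in small. nm E \<epsilon> (a \<epsilon> *\<^sub>R u \<epsilon>) \<le> inverse (\<rho> \<epsilon> ^ (M + N))"
    using M N ev_idx
  proof (eventually_elim)
    case (elim \<epsilon>)
    have "\<bar>a \<epsilon>\<bar> * nm E \<epsilon> (u \<epsilon>) \<le> inverse (\<rho> \<epsilon> ^ M) * inverse (\<rho> \<epsilon> ^ N)"
      using elim(1,2) normed_familyD(6)[OF E elim(3) mod_net_Car[OF u elim(3)]] rho(1)[OF elim(3)]
      by (intro mult_mono) auto
    then show ?case
      using normed_familyD(10)[OF E elim(3) mod_net_Car[OF u elim(3)]] by (simp add: power_add)
  qed
  then show ?thesis
    by (rule mod_netI[rotated]) (use normed_familyD(5)[OF E] mod_net_Car u in blast)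
qed

lemma negl_net_scale_left:
  assumes E: "normed_family E" and a: "negl_net \<rho> Rfam a" and u: "mod_net \<rho> E u"
  shows "negl_net \<rho> E (\<lambda>\<epsilon>. a \<epsilon> *\<^sub>R u \<epsilon>)"
  unfolding negl_net_def
proof (intro conjI allI ballI)
  show "a \<epsilon> *\<^sub>R u \<epsilon> \<in> Car E \<epsilon>" if "\<epsilon> \<in> idx" for \<epsilon>
    using normed_familyD(5)[OF E that] mod_net_Car[OF u that] by simp
  fix K
  obtain N where N: "\<forall>\<^sub>F \<epsilon> in small. nm E \<epsilon> (u \<epsilon>) \<le> inverse (\<rho> \<epsilon> ^ N)"
    using mod_netD[OF u] .
  show "\<forall>\<^sub>F \<epsilon> in small. nm E \<epsilon> (a \<epsilon> *\<^sub>R u \<epsilon>) \<le> \<rho> \<epsilon> ^ K"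
    \<comment> \<open>The growth exponent \<open>N\<close> of \<open>u\<close> is added to the
      target \<open>K\<close>, so that the product still decays like the power
      \<open>K\<close>.\<close>
    using negl_netD[OF a, of "K + N"] N ev_idx
  proof eventually_elim
    case (elim \<epsilon>)
    have "\<bar>a \<epsilon>\<bar> * nm E \<epsilon> (u \<epsilon>) \<le> \<rho> \<epsilon> ^ (K + N) * inverse (\<rho> \<epsilon> ^ N)"
      using elim(1,2) normed_familyD(6)[OF E elim(3) mod_net_Car[OF u elim(3)]] rho(1)[OF elim(3)]
      by (intro mult_mono) auto
    then show ?case
      using normed_familyD(10)[OF E elim(3) mod_net_Car[OF u elim(3)]] rho(1)[OF elim(3)]
      by (simp add: power_add mult.assoc)
  qed
qed

lemma negl_net_scale_right:
  assumes E: "normed_family E" and a: "mod_net \<rho> Rfam a" and u: "negl_net \<rho> E u"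
  shows "negl_net \<rho> E (\<lambda>\<epsilon>. a \<epsilon> *\<^sub>R u \<epsilon>)"
  unfolding negl_net_def
proof (intro conjI allI ballI)
  show "a \<epsilon> *\<^sub>R u \<epsilon> \<in> Car E \<epsilon>" if "\<epsilon> \<in> idx" for \<epsilon>
    using normed_familyD(5)[OF E that] negl_net_Car[OF u that] by simp
  fix K
  obtain N where N: "\<forall>\<^sub>F \<epsilon> in small. nm Rfam \<epsilon> (a \<epsilon>) \<le> inverse (\<rho> \<epsilon> ^ N)"
    using mod_netD[OF a] .
  show "\<forall>\<^sub>F \<epsilon> in small. nm E \<epsilon> (a \<epsilon> *\<^sub>R u \<epsilon>) \<le> \<rho> \<epsilon> ^ K"
    using negl_netD[OF u, of "K + N"] N ev_idx
  proof eventually_elim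
    case (elim \<epsilon>)
    have "nm E \<epsilon> (u \<epsilon>) * \<bar>a \<epsilon>\<bar> \<le> \<rho> \<epsilon> ^ (K + N) * inverse (\<rho> \<epsilon> ^ N)"
      using elim(1,2) normed_familyD(6)[OF E elim(3) negl_net_Car[OF u elim(3)]] rho(1)[OF elim(3)]
      by (intro mult_mono) auto
    then show ?case
      using normed_familyD(10)[OF E elim(3) negl_net_Car[OF u elim(3)]] rho(1)[OF elim(3)]
      by (simp add: power_add mult.assoc mult.commute[of "\<bar>a \<epsilon>\<bar>"])
  qed
qed

lemma mod_net_const [simp]: "mod_net \<rho> Rfam (\<lambda>_. c)"
proof (rule mod_netI)
  have "\<forall>\<^sub>F \<epsilon> in small. \<rho> \<epsilon> \<le> inverse (\<bar>c\<bar> + 1)" by (rule ev_rho_le) simp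
  with ev_idx show "\<forall>\<^sub>F \<epsilon> in small. nm Rfam \<epsilon> c \<le> inverse (\<rho> \<epsilon> ^ 1)"
  proof eventually_elim
    case (elim \<epsilon>)
    have "(\<bar>c\<bar> + 1) * \<rho> \<epsilon> \<le> 1" using elim(2) by (simp add: field_simps)
    then show ?case using rho(1)[OF elim(1)] by (simp add: field_simps)
  qed
qed simp

lemma mod_net_rho_pow [simp]: "mod_net \<rho> Rfam (\<lambda>\<epsilon>. \<rho> \<epsilon> ^ k)"
proof (rule mod_netI)
  show "\<forall>\<^sub>F \<epsilon> in small. nm Rfam \<epsilon> (\<rho> \<epsilon> ^ k) \<le> inverse (\<rho> \<epsilon> ^ 0)"
    using ev_idx by eventually_elim (use rho in \<open>simp add: power_le_one less_imp_le\<close>)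
qed simp

lemma mod_net_rho_inverse_pow [simp]: "mod_net \<rho> Rfam (\<lambda>\<epsilon>. inverse (\<rho> \<epsilon> ^ k))"
proof (rule mod_netI)
  show "\<forall>\<^sub>F \<epsilon> in small. nm Rfam \<epsilon> (inverse (\<rho> \<epsilon> ^ k)) \<le> inverse (\<rho> \<epsilon> ^ k)"
    using ev_idx by eventually_elim (use rho in \<open>simp add: less_imp_le\<close>)
qed simp

lemma negl_net_0 [simp]: "normed_family E \<Longrightarrow> negl_net \<rho> E (\<lambda>_. 0)"
  by (rule negl_netI)
    (use ev_idx in \<open>auto intro!: exI[of _ 1] elim!: eventually_mono simp: normed_familyD less_imp_le rho\<close>)

lemma mod_net_diff:
  "normed_family E \<Longrightarrow> mod_net \<rho> E u \<Longrightarrow> mod_net \<rho> E v \<Longrightarrow> mod_net \<rho> E (\<lambda>\<epsilon>. u \<epsilon> - v \<epsilon>)"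
  using mod_net_add[of E u "\<lambda>\<epsilon>. (-1) *\<^sub>R v \<epsilon>"] mod_net_scale[of E "\<lambda>_. -1" v] by simp

lemma negl_net_diff:
  "normed_family E \<Longrightarrow> negl_net \<rho> E u \<Longrightarrow> negl_net \<rho> E v \<Longrightarrow> negl_net \<rho> E (\<lambda>\<epsilon>. u \<epsilon> - v \<epsilon>)"
  using negl_net_add[of E u "\<lambda>\<epsilon>. (-1) *\<^sub>R v \<epsilon>"] negl_net_scale_right[of E "\<lambda>_. -1" v] by simp

lemma negl_net_minus_commute:
  "normed_family E \<Longrightarrow> negl_net \<rho> E (\<lambda>\<epsilon>. u \<epsilon> - v \<epsilon>) \<Longrightarrow> negl_net \<rho> E (\<lambda>\<epsilon>. v \<epsilon> - u \<epsilon>)"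
  using negl_net_scale_right[of E "\<lambda>_. -1" "\<lambda>\<epsilon>. u \<epsilon> - v \<epsilon>"] by simp

lemma negl_imp_mod: "negl_net \<rho> E u \<Longrightarrow> mod_net \<rho> E u"
  using negl_netD[of E u 0] by (intro mod_netI[of u E 0]) (auto simp: negl_net_Car)

lemma mod_net_mono:
  assumes "\<And>\<epsilon>. \<epsilon> \<in> idx \<Longrightarrow> u \<epsilon> \<in> Car E \<epsilon>"
    and "mod_net \<rho> Rfam v" "\<forall>\<^sub>F \<epsilon> in small. nm E \<epsilon> (u \<epsilon>) \<le> v \<epsilon>"
  shows "mod_net \<rho> E u"
proof -
  obtain N where "\<forall>\<^sub>F \<epsilon> in small. nm Rfam \<epsilon> (v \<epsilon>) \<le> inverse (\<rho> \<epsilon> ^ N)" using mod_netD[OF assms(2)] .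
  with assms(3) have "\<forall>\<^sub>F \<epsilon> in small. nm E \<epsilon> (u \<epsilon>) \<le> inverse (\<rho> \<epsilon> ^ N)" by eventually_elim simp
  then show ?thesis using assms(1) by (intro mod_netI)
qed

lemma negl_net_mono:
  assumes "\<And>\<epsilon>. \<epsilon> \<in> idx \<Longrightarrow> u \<epsilon> \<in> Car E \<epsilon>"
    and "negl_net \<rho> Rfam v" "\<forall>\<^sub>F \<epsilon> in small. nm E \<epsilon> (u \<epsilon>) \<le> v \<epsilon>"
  shows "negl_net \<rho> E u"
  unfolding negl_net_def
proof (intro conjI ballI allI)
  fix N
  show "\<forall>\<^sub>F \<epsilon> in small. nm E \<epsilon> (u \<epsilon>) \<le> \<rho> \<epsilon> ^ N"
    using negl_netD[OF assms(2), of N] assms(3) by eventually_elim simp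
qed (use assms in auto)

lemma mod_net_norm: "normed_family E \<Longrightarrow> mod_net \<rho> E u \<Longrightarrow> mod_net \<rho> Rfam (\<lambda>\<epsilon>. nm E \<epsilon> (u \<epsilon>))"
proof -
  assume E: "normed_family E" and u: "mod_net \<rho> E u"
  obtain N where N: "\<forall>\<^sub>F \<epsilon> in small. nm E \<epsilon> (u \<epsilon>) \<le> inverse (\<rho> \<epsilon> ^ N)" using mod_netD[OF u] .
  have "\<forall>\<^sub>F \<epsilon> in small. nm Rfam \<epsilon> (nm E \<epsilon> (u \<epsilon>)) \<le> inverse (\<rho> \<epsilon> ^ N)"
    using N ev_idx by eventually_elim (use normed_familyD(6)[OF E] mod_net_Car[OF u] in force)
  then show ?thesis by (intro mod_netI) auto
qed

lemma negl_net_norm: "normed_family E \<Longrightarrow> negl_net \<rho> E u \<Longrightarrow> negl_net \<rho> Rfam (\<lambda>\<epsilon>. nm E \<epsilon> (u \<epsilon>))"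
proof -
  assume E: "normed_family E" and u: "negl_net \<rho> E u"
  have "\<forall>\<^sub>F \<epsilon> in small. nm Rfam \<epsilon> (nm E \<epsilon> (u \<epsilon>)) \<le> \<rho> \<epsilon> ^ N" for N
    using negl_netD[OF u, of N] ev_idx by eventually_elim (use normed_familyD(6)[OF E] negl_net_Car[OF u] in force)
  then show ?thesis by (auto simp: negl_net_def)
qed

section \<open>Classes, their operations and their order in terms of representatives\<close>

lemma mem_cls_iff:
  assumes E: "normed_family E" and u: "mod_net \<rho> E u"
  shows "w \<in> cls \<rho> E idx u \<longleftrightarrow> w \<in> extensional idx \<and> mod_net \<rho> E w \<and> negl_net \<rho> E (\<lambda>\<epsilon>. u \<epsilon> - w \<epsilon>)"
proof -
  have "negl_net \<rho> E (\<lambda>\<epsilon>. restrict u idx \<epsilon> - w \<epsilon>) = negl_net \<rho> E (\<lambda>\<epsilon>. u \<epsilon> - w \<epsilon>)"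
    by (rule negl_net_cong) simp
  then show ?thesis
    using u unfolding cls_def grel_def
    by (auto simp: moderate_iff[OF E] negligible_iff[OF E] restrict_mod_net restrict_negl_net simp del: restrict_apply)
qed

lemma negl_net_diff_restrict: "normed_family E \<Longrightarrow> negl_net \<rho> E (\<lambda>\<epsilon>. u \<epsilon> - restrict u idx \<epsilon>)"
  by (rule iffD2[OF negl_net_cong negl_net_0]) simp_all

lemma restrict_in_cls:
  "normed_family E \<Longrightarrow> mod_net \<rho> E u \<Longrightarrow> restrict u idx \<in> cls \<rho> E idx u"
  by (simp add: mem_cls_iff restrict_mod_net negl_net_diff_restrict del: restrict_apply)

lemma cls_eq_iff:
  assumes E: "normed_family E" and u: "mod_net \<rho> E u" and v: "mod_net \<rho> E v"
  shows "cls \<rho> E idx u = cls \<rho> E idx v \<longleftrightarrow> negl_net \<rho> E (\<lambda>\<epsilon>. u \<epsilon> - v \<epsilon>)"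
proof
  assume "cls \<rho> E idx u = cls \<rho> E idx v"
  with restrict_in_cls[OF E v] have "negl_net \<rho> E (\<lambda>\<epsilon>. u \<epsilon> - restrict v idx \<epsilon>)"
    using mem_cls_iff[OF E u] by blast
  then show "negl_net \<rho> E (\<lambda>\<epsilon>. u \<epsilon> - v \<epsilon>)" by (rule iffD1[OF negl_net_cong, rotated]) simp
next
  have aux: "cls \<rho> E idx u \<subseteq> cls \<rho> E idx v"
    if "mod_net \<rho> E u" "mod_net \<rho> E v" "negl_net \<rho> E (\<lambda>\<epsilon>. v \<epsilon> - u \<epsilon>)" for u v
    using negl_net_add[OF E that(3)] that(1,2) by (force simp: mem_cls_iff[OF E])
  assume "negl_net \<rho> E (\<lambda>\<epsilon>. u \<epsilon> - v \<epsilon>)"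
  then show "cls \<rho> E idx u = cls \<rho> E idx v"
    using aux[OF u v] aux[OF v u] negl_net_minus_commute[OF E] by blast
qed

lemma G_eq:
  assumes E: "normed_family E"
  shows "G \<rho> E idx = cls \<rho> E idx ` {u. mod_net \<rho> E u}"
proof -
  have "G \<rho> E idx = (\<lambda>u. grel \<rho> E idx `` {u}) ` moderate \<rho> E idx"
    unfolding G_def quotient_def by blast
  also have "moderate \<rho> E idx = (\<lambda>u. restrict u idx) ` {u. mod_net \<rho> E u}"
    by (auto simp: moderate_iff[OF E] restrict_mod_net extensional_restrict intro!: image_eqI)
  also have "(\<lambda>u. grel \<rho> E idx `` {u}) ` (\<lambda>u. restrict u idx) ` {u. mod_net \<rho> E u} = cls \<rho> E idx ` {u. mod_net \<rho> E u}"
    by (simp add: image_image cls_def)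
  finally show ?thesis .
qed

lemma GE:
  assumes "normed_family E" "x \<in> G \<rho> E idx"
  obtains u where "mod_net \<rho> E u" "x = cls \<rho> E idx u"
  using assms by (auto simp: G_eq)

lemma cls_in_G: "normed_family E \<Longrightarrow> mod_net \<rho> E u \<Longrightarrow> cls \<rho> E idx u \<in> G \<rho> E idx"
  by (auto simp: G_eq)

text \<open>The operations on classes are unions over all representatives. Such a union collapses to
  one class once all its members agree; \<open>restrict u idx\<close> shows that it is not an empty
  union.\<close>

lemma UN_cls_eq:
  assumes E: "normed_family E" and u: "mod_net \<rho> E u"
    and F: "\<And>w. mod_net \<rho> E w \<Longrightarrow> negl_net \<rho> E (\<lambda>\<epsilon>. u \<epsilon> - w \<epsilon>) \<Longrightarrow> F w = X"
  shows "(\<Union>w\<in>cls \<rho> E idx u. F w) = X"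
proof -
  have "\<And>w. w \<in> cls \<rho> E idx u \<Longrightarrow> F w = X" using F by (auto simp: mem_cls_iff[OF E u])
  then show ?thesis using restrict_in_cls[OF E u] by blast
qed

lemma gadd_cls:
  assumes E: "normed_family E" and u: "mod_net \<rho> E u" and v: "mod_net \<rho> E v"
  shows "gadd \<rho> E (cls \<rho> E idx u) (cls \<rho> E idx v) = cls \<rho> E idx (\<lambda>\<epsilon>. u \<epsilon> + v \<epsilon>)"
  unfolding gadd_def
proof (intro UN_cls_eq[OF E u] UN_cls_eq[OF E v])
  fix w z assume a: "mod_net \<rho> E w" "negl_net \<rho> E (\<lambda>\<epsilon>. u \<epsilon> - w \<epsilon>)"
    "mod_net \<rho> E z" "negl_net \<rho> E (\<lambda>\<epsilon>. v \<epsilon> - z \<epsilon>)"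
  have "negl_net \<rho> E (\<lambda>\<epsilon>. (w \<epsilon> + z \<epsilon>) - (u \<epsilon> + v \<epsilon>))"
    using negl_net_add[OF E negl_net_minus_commute[OF E a(2)] negl_net_minus_commute[OF E a(4)]]
    by (simp add: algebra_simps)
  then show "cls \<rho> E idx (\<lambda>\<epsilon>. w \<epsilon> + z \<epsilon>) = cls \<rho> E idx (\<lambda>\<epsilon>. u \<epsilon> + v \<epsilon>)"
    using cls_eq_iff[OF E] mod_net_add[OF E] a u v by blast
qed

lemma gdiff_cls:
  assumes E: "normed_family E" and u: "mod_net \<rho> E u" and v: "mod_net \<rho> E v"
  shows "gdiff \<rho> E (cls \<rho> E idx u) (cls \<rho> E idx v) = cls \<rho> E idx (\<lambda>\<epsilon>. u \<epsilon> - v \<epsilon>)"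
  unfolding gdiff_def
proof (intro UN_cls_eq[OF E u] UN_cls_eq[OF E v])
  fix w z assume a: "mod_net \<rho> E w" "negl_net \<rho> E (\<lambda>\<epsilon>. u \<epsilon> - w \<epsilon>)"
    "mod_net \<rho> E z" "negl_net \<rho> E (\<lambda>\<epsilon>. v \<epsilon> - z \<epsilon>)"
  have "negl_net \<rho> E (\<lambda>\<epsilon>. (w \<epsilon> - z \<epsilon>) - (u \<epsilon> - v \<epsilon>))"
    using negl_net_diff[OF E negl_net_minus_commute[OF E a(2)] negl_net_minus_commute[OF E a(4)]]
    by (simp add: algebra_simps)
  then show "cls \<rho> E idx (\<lambda>\<epsilon>. w \<epsilon> - z \<epsilon>) = cls \<rho> E idx (\<lambda>\<epsilon>. u \<epsilon> - v \<epsilon>)"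
    using cls_eq_iff[OF E] mod_net_diff[OF E] a u v by blast
qed

lemma gscale_cls:
  assumes E: "normed_family E" and a: "mod_net \<rho> Rfam a" and u: "mod_net \<rho> E u"
  shows "gscale \<rho> E (cls \<rho> Rfam idx a) (cls \<rho> E idx u) = cls \<rho> E idx (\<lambda>\<epsilon>. a \<epsilon> *\<^sub>R u \<epsilon>)"
  unfolding gscale_def
proof (intro UN_cls_eq[OF normed_family_Rfam a] UN_cls_eq[OF E u])
  fix b w assume h: "mod_net \<rho> Rfam b" "negl_net \<rho> Rfam (\<lambda>\<epsilon>. a \<epsilon> - b \<epsilon>)"
    "mod_net \<rho> E w" "negl_net \<rho> E (\<lambda>\<epsilon>. u \<epsilon> - w \<epsilon>)"
  \<comment> \<open>The difference is split as \<open>(a - b) u + b (u - w)\<close>, where each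
    summand is a product of a negligible and a moderate net.\<close>
  have "negl_net \<rho> E (\<lambda>\<epsilon>. a \<epsilon> *\<^sub>R u \<epsilon> - b \<epsilon> *\<^sub>R w \<epsilon>)"
    using negl_net_add[OF E negl_net_scale_left[OF E h(2) u] negl_net_scale_right[OF E h(1,4)]]
    by (simp add: scaleR_diff_left scaleR_diff_right)
  then show "cls \<rho> E idx (\<lambda>\<epsilon>. b \<epsilon> *\<^sub>R w \<epsilon>) = cls \<rho> E idx (\<lambda>\<epsilon>. a \<epsilon> *\<^sub>R u \<epsilon>)"
    using cls_eq_iff[OF E] mod_net_scale[OF E] a h u by metis
qed

lemma gnorm_cls:
  assumes E: "normed_family E" and u: "mod_net \<rho> E u"
  shows "gnorm \<rho> E (cls \<rho> E idx u) = cls \<rho> Rfam idx (\<lambda>\<epsilon>. nm E \<epsilon> (u \<epsilon>))"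
  unfolding gnorm_def
proof (intro UN_cls_eq[OF E u])
  fix w assume w: "mod_net \<rho> E w" "negl_net \<rho> E (\<lambda>\<epsilon>. u \<epsilon> - w \<epsilon>)"
  have "negl_net \<rho> Rfam (\<lambda>\<epsilon>. nm E \<epsilon> (w \<epsilon>) - nm E \<epsilon> (u \<epsilon>))"
  proof (rule negl_net_mono[OF _ negl_net_norm[OF E w(2)]])
    show "\<forall>\<^sub>F \<epsilon> in small. nm Rfam \<epsilon> (nm E \<epsilon> (w \<epsilon>) - nm E \<epsilon> (u \<epsilon>)) \<le> nm E \<epsilon> (u \<epsilon> - w \<epsilon>)"
      using ev_idx
    proof eventually_elim
      case (elim \<epsilon>)
      note D = normed_familyD[OF E elim]
      have c: "u \<epsilon> \<in> Car E \<epsilon>" "w \<epsilon> \<in> Car E \<epsilon>" using u w(1) elim by (auto intro: mod_net_Car)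
      show ?case
        using D(9)[OF D(4)[OF c] c(2)] D(9)[OF D(4)[OF c(2,1)] c(1)] D(11)[OF c] by simp
    qed
  qed simp
  then show "cls \<rho> Rfam idx (\<lambda>\<epsilon>. nm E \<epsilon> (w \<epsilon>)) = cls \<rho> Rfam idx (\<lambda>\<epsilon>. nm E \<epsilon> (u \<epsilon>))"
    using cls_eq_iff[OF normed_family_Rfam] mod_net_norm[OF E] u w(1) by blast
qed

text \<open>The order only sees representatives up to every power of the gauge. An excess of
  \<open>u\<close> over \<open>v\<close> that is below all powers can be moved into the
  representative of the right-hand class.\<close>

lemma rle_cls_iff:
  assumes u: "mod_net \<rho> Rfam u" and v: "mod_net \<rho> Rfam v"
  shows "rle (cls \<rho> Rfam idx u) (cls \<rho> Rfam idx v) \<longleftrightarrow> (\<forall>j. \<forall>\<^sub>F \<epsilon> in small. u \<epsilon> \<le> v \<epsilon> + \<rho> \<epsilon> ^ j)"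
proof (intro iffI allI)
  note R = normed_family_Rfam
  fix j
  assume "rle (cls \<rho> Rfam idx u) (cls \<rho> Rfam idx v)"
  then obtain w where w: "w \<in> cls \<rho> Rfam idx v" "\<forall>\<^sub>F \<epsilon> in small. restrict u idx \<epsilon> \<le> w \<epsilon>"
    using restrict_in_cls[OF R u] unfolding rle_def by blast
  have "negl_net \<rho> Rfam (\<lambda>\<epsilon>. v \<epsilon> - w \<epsilon>)" using w(1) mem_cls_iff[OF R v] by blast
  from negl_netD[OF this, of j] w(2) ev_idx
  show "\<forall>\<^sub>F \<epsilon> in small. u \<epsilon> \<le> v \<epsilon> + \<rho> \<epsilon> ^ j" by eventually_elim auto
next
  note R = normed_family_Rfam
  assume ev: "\<forall>j. \<forall>\<^sub>F \<epsilon> in small. u \<epsilon> \<le> v \<epsilon> + \<rho> \<epsilon> ^ j"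
  show "rle (cls \<rho> Rfam idx u) (cls \<rho> Rfam idx v)"
    unfolding rle_def
  proof
    fix u' assume u': "u' \<in> cls \<rho> Rfam idx u"
    \<comment> \<open>Raising \<open>v\<close> to \<open>u'\<close> where necessary changes it by a
      negligible amount only, so this is the required representative above
      \<open>u'\<close>.\<close>
    define v' where "v' = (\<lambda>\<epsilon>. max (u' \<epsilon>) (v \<epsilon>))"
    have un: "negl_net \<rho> Rfam (\<lambda>\<epsilon>. u \<epsilon> - u' \<epsilon>)" using u' mem_cls_iff[OF R u] by blast
    have vn: "negl_net \<rho> Rfam (\<lambda>\<epsilon>. v \<epsilon> - v' \<epsilon>)"
    proof (rule negl_netI)
      fix N
      have "\<forall>\<^sub>F \<epsilon> in small. nm Rfam \<epsilon> (v \<epsilon> - v' \<epsilon>) \<le> 2 * \<rho> \<epsilon> ^ N"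
        using negl_netD[OF un, of N] ev[rule_format, of N] by eventually_elim (auto simp: v'_def)
      then show "\<exists>c>0. \<forall>\<^sub>F \<epsilon> in small. nm Rfam \<epsilon> (v \<epsilon> - v' \<epsilon>) \<le> c * \<rho> \<epsilon> ^ N"
        by (intro exI[of _ 2]) simp
    qed simp
    have vm: "mod_net \<rho> Rfam v'"
      using mod_net_diff[OF R v negl_imp_mod[OF vn]] by simp
    have "restrict v' idx \<in> cls \<rho> Rfam idx v"
      using restrict_in_cls[OF R vm] cls_eq_iff[OF R v vm] vn by simp
    moreover have "\<forall>\<^sub>F \<epsilon> in small. u' \<epsilon> \<le> restrict v' idx \<epsilon>"
      using ev_idx by eventually_elim (simp add: v'_def)
    ultimately show "\<exists>v\<in>cls \<rho> Rfam idx v. \<forall>\<^sub>F \<epsilon> in small. u' \<epsilon> \<le> v \<epsilon>" by blast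
  qed
qed

text \<open>A moderate inverse, of growth exponent \<open>N\<close>, keeps the absolute value of
  \<open>u\<close> above half of the \<open>N\<close>-th power of the gauge; nonnegativity up to a
  higher power then decides the sign. Conversely such a lower bound makes the pointwise inverse
  moderate.\<close>

lemma rpos_cls_iff:
  assumes u: "mod_net \<rho> Rfam u"
  shows "rpos \<rho> (cls \<rho> Rfam idx u) \<longleftrightarrow> (\<exists>k. \<forall>\<^sub>F \<epsilon> in small. \<rho> \<epsilon> ^ k \<le> u \<epsilon>)"
proof
  note R = normed_family_Rfam
  assume "rpos \<rho> (cls \<rho> Rfam idx u)"
  then have nonneg: "\<And>j. \<forall>\<^sub>F \<epsilon> in small. 0 \<le> u \<epsilon> + \<rho> \<epsilon> ^ j"
    and "rinvertible \<rho> (cls \<rho> Rfam idx u)"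
    unfolding rpos_def rconst_def by (auto simp: rle_cls_iff[OF _ u])
  then obtain y where y: "mod_net \<rho> Rfam y"
    and "gscale \<rho> Rfam (cls \<rho> Rfam idx u) (cls \<rho> Rfam idx y) = rconst \<rho> 1"
    unfolding rinvertible_def by (auto elim!: GE[OF R])
  then have "negl_net \<rho> Rfam (\<lambda>\<epsilon>. u \<epsilon> * y \<epsilon> - 1)"
    using cls_eq_iff[OF R mod_net_scale[OF R u y] mod_net_const, of 1]
    by (simp add: gscale_cls[OF R u y] rconst_def)
  from negl_netD[OF this, of 1]
  have uy: "\<forall>\<^sub>F \<epsilon> in small. \<bar>u \<epsilon> * y \<epsilon> - 1\<bar> \<le> \<rho> \<epsilon>" by simp
  obtain N where N: "\<forall>\<^sub>F \<epsilon> in small. nm Rfam \<epsilon> (y \<epsilon>) \<le> inverse (\<rho> \<epsilon> ^ N)" using mod_netD[OF y] .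
  \<comment> \<open>The value 1/4 keeps the product of \<open>u\<close> and \<open>y\<close> above
    1/2 in absolute value, and power \<open>N + 1\<close> of the gauge below a quarter of power
    \<open>N\<close>. A negative \<open>u\<close> would lie below minus one half of power
    \<open>N\<close>, against the lower bound given by power \<open>N + 2\<close>.\<close>
  have quarter: "\<forall>\<^sub>F \<epsilon> in small. \<rho> \<epsilon> \<le> 1/4" by (rule ev_rho_le) simp
  have "\<forall>\<^sub>F \<epsilon> in small. \<rho> \<epsilon> ^ Suc N \<le> u \<epsilon>"
    using uy N nonneg[of "Suc (Suc N)"] quarter ev_idx
  proof (eventually_elim)
    case (elim \<epsilon>)
    note r = rho(1)[OF elim(5)]
    define q where "q = \<rho> \<epsilon> ^ N"
    have q: "q > 0" using r by (simp add: q_def)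
    have "1/2 \<le> \<bar>u \<epsilon>\<bar> * \<bar>y \<epsilon>\<bar>" using elim(1,4) by (simp add: abs_mult[symmetric])
    also have "\<dots> \<le> \<bar>u \<epsilon>\<bar> * inverse q" using elim(2) by (intro mult_left_mono) (simp_all add: q_def)
    finally have "q / 2 \<le> \<bar>u \<epsilon>\<bar>" using q by (simp add: field_simps)
    moreover define p where "p = \<rho> \<epsilon> * q"
    moreover have "p \<le> q / 4" using elim(4) q by (simp add: p_def)
    moreover have "\<rho> \<epsilon> * p \<le> 1 * p" using r rho(2)[OF elim(5)] q by (intro mult_right_mono) (auto simp: p_def)
    moreover have "0 \<le> u \<epsilon> + \<rho> \<epsilon> * p" using elim(3) by (simp add: p_def q_def)
    ultimately have "p \<le> u \<epsilon>" using q by linarith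
    then show ?case by (simp add: p_def q_def)
  qed
  then show "\<exists>k. \<forall>\<^sub>F \<epsilon> in small. \<rho> \<epsilon> ^ k \<le> u \<epsilon>" ..
next
  note R = normed_family_Rfam
  assume "\<exists>k. \<forall>\<^sub>F \<epsilon> in small. \<rho> \<epsilon> ^ k \<le> u \<epsilon>"
  then obtain k where k: "\<forall>\<^sub>F \<epsilon> in small. \<rho> \<epsilon> ^ k \<le> u \<epsilon>" ..
  have "mod_net \<rho> Rfam (\<lambda>\<epsilon>. inverse (u \<epsilon>))"
  proof (rule mod_netI)
    show "\<forall>\<^sub>F \<epsilon> in small. nm Rfam \<epsilon> (inverse (u \<epsilon>)) \<le> inverse (\<rho> \<epsilon> ^ k)"
      using k ev_idx
    proof eventually_elim
      case (elim \<epsilon>)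
      have "0 < \<rho> \<epsilon> ^ k" using rho[OF elim(2)] by simp
      then show ?case using elim(1) by (simp add: le_imp_inverse_le)
    qed
  qed simp
  moreover have "negl_net \<rho> Rfam (\<lambda>\<epsilon>. u \<epsilon> *\<^sub>R inverse (u \<epsilon>) - 1)"
  proof (rule negl_net_mono[OF _ negl_net_0[OF R]])
    show "\<forall>\<^sub>F \<epsilon> in small. nm Rfam \<epsilon> (u \<epsilon> *\<^sub>R inverse (u \<epsilon>) - 1) \<le> 0"
      using k ev_idx
    proof eventually_elim
      case (elim \<epsilon>)
      have "0 < \<rho> \<epsilon> ^ k" using rho[OF elim(2)] by simp
      then show ?case using elim(1) by simp
    qed
  qed simp
  ultimately have "rinvertible \<rho> (cls \<rho> Rfam idx u)"
    unfolding rinvertible_def rconst_def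
    by (intro bexI[of _ "cls \<rho> Rfam idx (\<lambda>\<epsilon>. inverse (u \<epsilon>))"])
      (simp_all only: gscale_cls[OF R u] cls_in_G[OF R] cls_eq_iff[OF R] mod_net_scale[OF R] u mod_net_const)
  moreover have "\<forall>\<^sub>F \<epsilon> in small. 0 \<le> u \<epsilon> + \<rho> \<epsilon> ^ j" for j
    using k ev_idx
  proof eventually_elim
    case (elim \<epsilon>)
    have "0 < \<rho> \<epsilon> ^ k" "0 < \<rho> \<epsilon> ^ j" using rho[OF elim(2)] by simp_all
    then show ?case using elim(1) by simp
  qed
  ultimately show "rpos \<rho> (cls \<rho> Rfam idx u)"
    unfolding rpos_def rconst_def by (simp add: rle_cls_iff u)
qed

text \<open>A strict inequality between generalized numbers is a pointwise inequality with a margin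
  of some fixed power of the gauge. That margin is what makes openness visible on
  representatives.\<close>

lemma mem_gball_iff:
  assumes E: "normed_family E" and r: "mod_net \<rho> Rfam r" and u: "mod_net \<rho> E u" and v: "mod_net \<rho> E v"
  shows "cls \<rho> E idx v \<in> gball \<rho> E (cls \<rho> Rfam idx r) (cls \<rho> E idx u)
    \<longleftrightarrow> (\<exists>k. \<forall>\<^sub>F \<epsilon> in small. nm E \<epsilon> (u \<epsilon> - v \<epsilon>) + \<rho> \<epsilon> ^ k \<le> r \<epsilon>)"
proof -
  note m = mod_net_norm[OF E mod_net_diff[OF E u v]]
  show ?thesis
    unfolding gball_def rless_def
    by (simp add: cls_in_G[OF E v] gdiff_cls[OF E u v] gnorm_cls[OF E mod_net_diff[OF E u v]]
        gdiff_cls[OF normed_family_Rfam r m] rpos_cls_iff[OF mod_net_diff[OF normed_family_Rfam r m]] le_diff_eq add.commute)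
qed

end

section \<open>Strongly internal sets\<close>

definition inner_part :: "(real \<Rightarrow> real) \<Rightarrow> 'a::real_vector nfam \<Rightarrow> (real \<Rightarrow> 'a set) \<Rightarrow> nat \<Rightarrow> real \<Rightarrow> 'a set" where
  "inner_part \<rho> E A n \<epsilon> = {x \<in> Car E \<epsilon>. \<forall>y\<in>Car E \<epsilon>. nm E \<epsilon> (y - x) \<le> \<rho> \<epsilon> ^ n \<longrightarrow> y \<in> A \<epsilon>}"

text \<open>Turns the failure of an eventual property into an index set accumulating at 0, the form
  that strong disjointness asks for.\<close>

lemma not_eventually_imp_closure:
  assumes "\<not> (\<forall>\<^sub>F \<epsilon> in small. P \<epsilon>)"
  shows "0 \<in> closure {\<epsilon>\<in>idx. \<not> P \<epsilon>}"
  unfolding closure_approachable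
proof (intro allI impI)
  fix e :: real assume "0 < e"
  then have "\<exists>\<epsilon>\<in>idx. \<epsilon> \<noteq> 0 \<and> dist \<epsilon> 0 < e \<and> \<not> P \<epsilon>"
    using assms unfolding eventually_at by blast
  then show "\<exists>y\<in>{\<epsilon>\<in>idx. \<not> P \<epsilon>}. dist y 0 < e" by blast
qed

context gauge
begin

lemma inner_part_mono: "\<epsilon> \<in> idx \<Longrightarrow> m \<le> n \<Longrightarrow> inner_part \<rho> E A m \<epsilon> \<subseteq> inner_part \<rho> E A n \<epsilon>"
  unfolding inner_part_def using rho_pow_mono[of \<epsilon> m n] by (blast intro: order_trans)

text \<open>A point near the convex combination is reached by translating both end points by the
  same small vector \<open>d\<close>. The translated end points lie in \<open>A\<close>, and so does
  their combination.\<close>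

lemma convex_inner_part:
  assumes E: "normed_family E" and e: "\<epsilon> \<in> idx" and A: "convex (A \<epsilon>)"
  shows "convex (inner_part \<rho> E A n \<epsilon>)"
proof (rule convexI)
  note D = normed_familyD[OF E e]
  fix x y and s t :: real
  assume xy: "x \<in> inner_part \<rho> E A n \<epsilon>" "y \<in> inner_part \<rho> E A n \<epsilon>" and st: "0 \<le> s" "0 \<le> t" "s + t = 1"
  have c: "x \<in> Car E \<epsilon>" "y \<in> Car E \<epsilon>" using xy by (auto simp: inner_part_def)
  have xyc: "s *\<^sub>R x + t *\<^sub>R y \<in> Car E \<epsilon>" by (intro D(3) D(5) c)
  moreover have "z \<in> A \<epsilon>"
    if z: "z \<in> Car E \<epsilon>" "nm E \<epsilon> (z - (s *\<^sub>R x + t *\<^sub>R y)) \<le> \<rho> \<epsilon> ^ n" for z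
  proof -
    define d where "d = z - (s *\<^sub>R x + t *\<^sub>R y)"
    have d: "d \<in> Car E \<epsilon>" unfolding d_def by (rule D(4)[OF z(1) xyc])
    have "x + d \<in> A \<epsilon>" "y + d \<in> A \<epsilon>"
      using xy z(2) D(3)[OF c(1) d] D(3)[OF c(2) d] unfolding inner_part_def d_def[symmetric] by auto
    then have "s *\<^sub>R (x + d) + t *\<^sub>R (y + d) \<in> A \<epsilon>" using A st by (auto intro: convexD)
    also have "s *\<^sub>R (x + d) + t *\<^sub>R (y + d) = s *\<^sub>R x + t *\<^sub>R y + (s + t) *\<^sub>R d"
      by (simp add: algebra_simps)
    also have "\<dots> = z" using st by (simp add: d_def)
    finally show ?thesis .
  qed
  ultimately show "s *\<^sub>R x + t *\<^sub>R y \<in> inner_part \<rho> E A n \<epsilon>" unfolding inner_part_def by blast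
qed

text \<open>Inner parts increase with \<open>n\<close>, so two points lie in the larger of their two
  inner parts. As \<open>max k l\<close> is one of \<open>k\<close> and \<open>l\<close>, no
  monotonicity of \<open>P\<close> has to be assumed.\<close>

lemma convex_UN_inner_part:
  assumes E: "normed_family E" and e: "\<epsilon> \<in> idx" and A: "convex (A \<epsilon>)"
  shows "convex (\<Union>{inner_part \<rho> E A n \<epsilon> |n. P (inner_part \<rho> E A n \<epsilon>)})"
    (is "convex ?C")
proof (rule convexI)
  fix x y and s t :: real
  assume "x \<in> ?C" "y \<in> ?C" and st: "0 \<le> s" "0 \<le> t" "s + t = 1"
  then obtain k l where k: "x \<in> inner_part \<rho> E A k \<epsilon>" "P (inner_part \<rho> E A k \<epsilon>)"
    and l: "y \<in> inner_part \<rho> E A l \<epsilon>" "P (inner_part \<rho> E A l \<epsilon>)" by blast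
  have "x \<in> inner_part \<rho> E A (max k l) \<epsilon>" "y \<in> inner_part \<rho> E A (max k l) \<epsilon>"
    using inner_part_mono[OF e, of k "max k l" E A] inner_part_mono[OF e, of l "max k l" E A] k l by auto
  then have "s *\<^sub>R x + t *\<^sub>R y \<in> inner_part \<rho> E A (max k l) \<epsilon>"
    using convexD[OF convex_inner_part[OF E e, of A "max k l"]] A st by blast
  moreover have "P (inner_part \<rho> E A (max k l) \<epsilon>)" using k l by (simp add: max_def)
  ultimately show "s *\<^sub>R x + t *\<^sub>R y \<in> ?C" by blast
qed

lemma strongly_internal_imp_inner_part:
  assumes E: "normed_family E" and u: "mod_net \<rho> E u"
    and si: "cls \<rho> E idx u \<in> strongly_internal \<rho> E A"
  shows "\<exists>n. \<forall>\<^sub>F \<epsilon> in small. u \<epsilon> \<in> inner_part \<rho> E A n \<epsilon>"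
proof (rule ccontr)
  assume "\<not> ?thesis"
  then have freq: "0 \<in> closure {\<epsilon>\<in>idx. u \<epsilon> \<notin> inner_part \<rho> E A n \<epsilon>}" for n
    by (intro not_eventually_imp_closure) blast
  \<comment> \<open>Moving \<open>u\<close> out of \<open>A\<close> along a null sequence \<open>e\<close>, by at most \<open>\<rho> (e n) ^ n\<close> at \<open>e n\<close>, gives a
    representative of the same class that is not eventually in \<open>A\<close>. The sequence need not be injective,
    but it takes each value only finitely often.\<close>
  have "\<exists>\<epsilon> y. \<epsilon> \<in> idx \<and> \<bar>\<epsilon>\<bar> < inverse (Suc n) \<and> y \<in> Car E \<epsilon> \<and> nm E \<epsilon> (y - u \<epsilon>) \<le> \<rho> \<epsilon> ^ n \<and> y \<notin> A \<epsilon>" for n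
  proof -
    obtain \<epsilon> where "\<epsilon> \<in> idx" "u \<epsilon> \<notin> inner_part \<rho> E A n \<epsilon>" "\<bar>\<epsilon>\<bar> < inverse (Suc n)"
      using freq[of n, unfolded closure_approachable, rule_format, of "inverse (Suc n)"] by auto
    then show ?thesis using mod_net_Car[OF u] unfolding inner_part_def by blast
  qed
  then obtain e y where e: "\<And>n. e n \<in> idx" "\<And>n. \<bar>e n\<bar> < inverse (Suc n)"
    and y: "\<And>n. y n \<in> Car E (e n)" "\<And>n. nm E (e n) (y n - u (e n)) \<le> \<rho> (e n) ^ n" "\<And>n. y n \<notin> A (e n)"
    by metis
  \<comment> \<open>The choice selects one index for each value of \<open>e\<close>. It may differ
    from the index at hand, but it belongs to the same point, which is all that
    \<open>w_range\<close> records.\<close>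
  define w where "w \<epsilon> = (if \<epsilon> \<in> range e then y (SOME n. e n = \<epsilon>) else u \<epsilon>)" for \<epsilon>
  have w_range: "\<exists>k. e k = e n \<and> w (e n) = y k" for n
  proof -
    have "e (SOME k. e k = e n) = e n" by (rule someI[of _ n]) simp
    then show ?thesis unfolding w_def by auto
  qed
  have wC: "w \<epsilon> \<in> Car E \<epsilon>" if "\<epsilon> \<in> idx" for \<epsilon>
  proof (cases "\<epsilon> \<in> range e")
    case True
    then show ?thesis using w_range y(1) by (metis imageE)
  next
    case False
    then show ?thesis using mod_net_Car[OF u that] by (simp add: w_def)
  qed
  have neg: "negl_net \<rho> E (\<lambda>\<epsilon>. w \<epsilon> - u \<epsilon>)"
    unfolding negl_net_def
  proof (intro conjI ballI allI)
    fix K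
    \<comment> \<open>Near 0 the finitely many values \<open>e 0\<close> to \<open>e K\<close> are
      avoided, so every index chosen there exceeds \<open>K\<close> and the displacement is at most
      the power \<open>K\<close> of the gauge.\<close>
    have "open (- (e ` {..K}))" by (intro open_Compl finite_imp_closed) simp
    moreover have "e n \<noteq> 0" for n using e(1)[of n] by auto
    then have "0 \<in> - (e ` {..K})" by (metis ComplI imageE)
    ultimately have "\<forall>\<^sub>F \<epsilon> in nhds 0. \<epsilon> \<in> - (e ` {..K})" by (rule eventually_nhds_in_open)
    then have "\<forall>\<^sub>F \<epsilon> in small. \<epsilon> \<in> - (e ` {..K})" by (simp add: eventually_at_filter eventually_mono)
    then show "\<forall>\<^sub>F \<epsilon> in small. nm E \<epsilon> (w \<epsilon> - u \<epsilon>) \<le> \<rho> \<epsilon> ^ K" using ev_idx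
    proof eventually_elim
      case (elim \<epsilon>)
      show ?case
      proof (cases "\<epsilon> \<in> range e")
        case True
        then obtain n where "\<epsilon> = e n" by auto
        then obtain k where k: "\<epsilon> = e k" "w \<epsilon> = y k" using w_range[of n] by metis
        have "K \<le> k" using elim(1) k(1) by force
        then show ?thesis using y(2)[of k] k rho_pow_mono[OF elim(2), of K k] by simp
      next
        case False
        then show ?thesis using normed_familyD(8)[OF E elim(2)] rho(1)[OF elim(2)] by (simp add: w_def)
      qed
    qed
  next
    show "w \<epsilon> - u \<epsilon> \<in> Car E \<epsilon>" if "\<epsilon> \<in> idx" for \<epsilon>
      using normed_familyD(4)[OF E that] wC[OF that] mod_net_Car[OF u that] by blast
  qed
  have wm: "mod_net \<rho> E w" using mod_net_add[OF E negl_imp_mod[OF neg] u] by simp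
  have "restrict w idx \<in> cls \<rho> E idx u"
    using restrict_in_cls[OF E wm] cls_eq_iff[OF E wm u] neg by simp
  then have "\<forall>\<^sub>F \<epsilon> in small. restrict w idx \<epsilon> \<in> A \<epsilon>" using si unfolding strongly_internal_def by blast
  then obtain d where d: "d > 0" "\<And>\<epsilon>. \<epsilon> \<in> idx \<Longrightarrow> \<epsilon> \<noteq> 0 \<Longrightarrow> dist \<epsilon> 0 < d \<Longrightarrow> restrict w idx \<epsilon> \<in> A \<epsilon>"
    unfolding eventually_at by blast
  obtain n where "inverse (Suc n) < d" using reals_Archimedean[OF d(1)] by auto
  then have "dist (e n) 0 < d" using e(2)[of n] by (simp add: dist_real_def)
  moreover have "e n \<noteq> 0" using e(1)[of n] by auto
  ultimately have "restrict w idx (e n) \<in> A (e n)" using d(2) e(1) by blast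
  then have "w (e n) \<in> A (e n)" using e(1)[of n] by (simp del: greaterThanAtMost_iff)
  then show False using w_range[of n] y(3) by metis
qed

text \<open>Another representative is eventually within the radius that \<open>inner_part\<close>
  allows, because it differs from \<open>u\<close> by a negligible net.\<close>

lemma inner_part_imp_strongly_internal:
  assumes E: "normed_family E" and u: "mod_net \<rho> E u"
    and ev: "\<forall>\<^sub>F \<epsilon> in small. u \<epsilon> \<in> inner_part \<rho> E A n \<epsilon>"
  shows "cls \<rho> E idx u \<in> strongly_internal \<rho> E A"
proof -
  have "\<forall>\<^sub>F \<epsilon> in small. w \<epsilon> \<in> A \<epsilon>" if "w \<in> cls \<rho> E idx u" for w
  proof -
    have w: "mod_net \<rho> E w" "negl_net \<rho> E (\<lambda>\<epsilon>. u \<epsilon> - w \<epsilon>)" using that mem_cls_iff[OF E u] by auto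
    from negl_netD[OF negl_net_minus_commute[OF E w(2)], of n] ev ev_idx show ?thesis
      by eventually_elim (use mod_net_Car[OF w(1)] in \<open>auto simp: inner_part_def\<close>)
  qed
  then show ?thesis unfolding strongly_internal_def using cls_in_G[OF E u] by blast
qed

lemma internalI:
  assumes E: "normed_family E" and u: "mod_net \<rho> E u" and ev: "\<forall>\<^sub>F \<epsilon> in small. u \<epsilon> \<in> A \<epsilon>"
  shows "cls \<rho> E idx u \<in> internal \<rho> E A"
proof -
  have "\<forall>\<^sub>F \<epsilon> in small. restrict u idx \<epsilon> \<in> A \<epsilon>" using ev ev_idx by eventually_elim simp
  then show ?thesis unfolding internal_def using cls_in_G[OF E u] restrict_in_cls[OF E u] by blast
qed

lemma internalE:
  assumes E: "normed_family E" and x: "x \<in> internal \<rho> E A"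
  obtains u where "mod_net \<rho> E u" "x = cls \<rho> E idx u" "\<forall>\<^sub>F \<epsilon> in small. u \<epsilon> \<in> A \<epsilon>"
proof -
  obtain w where w: "mod_net \<rho> E w" "x = cls \<rho> E idx w" using x GE[OF E] unfolding internal_def by blast
  obtain u where u: "u \<in> x" "\<forall>\<^sub>F \<epsilon> in small. u \<epsilon> \<in> A \<epsilon>" using x unfolding internal_def by blast
  have "mod_net \<rho> E u" "negl_net \<rho> E (\<lambda>\<epsilon>. w \<epsilon> - u \<epsilon>)" using u w mem_cls_iff[OF E] by auto
  then show ?thesis using that u w cls_eq_iff[OF E] by blast
qed

text \<open>A representative of the first class, kept on \<open>L\<close> and replaced by
  \<open>q\<close> elsewhere, represents the second class and has the same restriction to
  \<open>L\<close>. This compares the two unions directly, without any analysis of the quotient over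
  \<open>L\<close>.\<close>

lemma grestrict_subset:
  assumes E: "normed_family E" and L: "L \<subseteq> idx" and p: "mod_net \<rho> E p" and q: "mod_net \<rho> E q"
    and eq: "\<And>\<epsilon>. \<epsilon> \<in> L \<Longrightarrow> p \<epsilon> = q \<epsilon>"
  shows "grestrict \<rho> E L (cls \<rho> E idx p) \<subseteq> grestrict \<rho> E L (cls \<rho> E idx q)"
proof -
  have "\<exists>w'\<in>cls \<rho> E idx q. cls \<rho> E L w = cls \<rho> E L w'" if "w \<in> cls \<rho> E idx p" for w
  proof -
    have w: "mod_net \<rho> E w" "negl_net \<rho> E (\<lambda>\<epsilon>. p \<epsilon> - w \<epsilon>)" using that mem_cls_iff[OF E p] by auto
    define v where "v \<epsilon> = (if \<epsilon> \<in> L then w \<epsilon> else q \<epsilon>)" for \<epsilon>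
    have vC: "v \<epsilon> \<in> Car E \<epsilon>" if "\<epsilon> \<in> idx" for \<epsilon>
      using mod_net_Car[OF w(1) that] mod_net_Car[OF q that] by (simp add: v_def)
    have neg: "negl_net \<rho> E (\<lambda>\<epsilon>. v \<epsilon> - q \<epsilon>)"
    proof (rule negl_net_mono[OF _ negl_net_norm[OF E negl_net_minus_commute[OF E w(2)]]])
      show "v \<epsilon> - q \<epsilon> \<in> Car E \<epsilon>" if "\<epsilon> \<in> idx" for \<epsilon>
        using normed_familyD(4)[OF E that] vC[OF that] mod_net_Car[OF q that] by blast
      show "\<forall>\<^sub>F \<epsilon> in small. nm E \<epsilon> (v \<epsilon> - q \<epsilon>) \<le> nm E \<epsilon> (w \<epsilon> - p \<epsilon>)"
        using ev_idx
      proof eventually_elim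
        case (elim \<epsilon>)
        note D = normed_familyD[OF E elim]
        show ?case
          using D(6)[OF D(4)[OF mod_net_Car[OF w(1) elim] mod_net_Car[OF p elim]]] D(8) eq
          by (simp add: v_def)
      qed
    qed
    have vm: "mod_net \<rho> E v" using mod_net_add[OF E negl_imp_mod[OF neg] q] by simp
    have "restrict v idx \<in> cls \<rho> E idx q"
      using restrict_in_cls[OF E vm] cls_eq_iff[OF E vm q] neg by simp
    moreover have "restrict w L = restrict (restrict v idx) L" 
      by (rule ext) (use L in \<open>auto simp: v_def restrict_def simp del: greaterThanAtMost_iff\<close>)
    ultimately show ?thesis unfolding cls_def by metis
  qed
  then show ?thesis unfolding grestrict_def by blast
qed

text \<open>If the inner part met \<open>B\<close> along a set \<open>L\<close> accumulating at 0,
  common points \<open>w\<close> on \<open>L\<close> could be completed off \<open>L\<close> by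
  \<open>a\<close> to an element of the strongly internal set and by \<open>b\<close> to one of the
  internal set. The two would have equal restrictions to \<open>L\<close>.\<close>

lemma strongly_disjoint_imp_inner_part_disjoint:
  assumes E: "normed_family E"
    and disj: "strongly_disjoint \<rho> E (strongly_internal \<rho> E A) (internal \<rho> E B)"
    and BC: "\<And>\<epsilon>. \<epsilon> \<in> idx \<Longrightarrow> B \<epsilon> \<subseteq> Car E \<epsilon>" and bnd: "sharply_bounded \<rho> E B"
    and a: "mod_net \<rho> E a" "\<forall>\<^sub>F \<epsilon> in small. a \<epsilon> \<in> inner_part \<rho> E A m \<epsilon>"
    and b: "mod_net \<rho> E b" "\<forall>\<^sub>F \<epsilon> in small. b \<epsilon> \<in> B \<epsilon>"
  shows "\<forall>\<^sub>F \<epsilon> in small. inner_part \<rho> E A n \<epsilon> \<inter> B \<epsilon> = {}"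
proof (rule ccontr)
  assume neg: "\<not> ?thesis"
  define L where "L = {\<epsilon>\<in>idx. inner_part \<rho> E A n \<epsilon> \<inter> B \<epsilon> \<noteq> {}}"
  have L: "L \<subseteq> idx" "0 \<in> closure L" using not_eventually_imp_closure[OF neg] by (auto simp: L_def)
  have "\<forall>\<epsilon>. \<exists>x. \<epsilon> \<in> L \<longrightarrow> x \<in> inner_part \<rho> E A n \<epsilon> \<inter> B \<epsilon>" unfolding L_def by blast
  then obtain w where w: "\<And>\<epsilon>. \<epsilon> \<in> L \<Longrightarrow> w \<epsilon> \<in> inner_part \<rho> E A n \<epsilon>" "\<And>\<epsilon>. \<epsilon> \<in> L \<Longrightarrow> w \<epsilon> \<in> B \<epsilon>"
    by (metis IntE)
  obtain N where N: "\<forall>\<^sub>F \<epsilon> in small. \<forall>u\<in>B \<epsilon>. nm E \<epsilon> u \<le> inverse (\<rho> \<epsilon> ^ N)"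
    using bnd unfolding sharply_bounded_def by blast
  \<comment> \<open>The points \<open>w\<close> are chosen freely inside \<open>B\<close>; the sharp
    bound on \<open>B\<close> is what makes the glued nets moderate.\<close>
  have patch: "mod_net \<rho> E (\<lambda>\<epsilon>. if \<epsilon> \<in> L then w \<epsilon> else u \<epsilon>)" if u: "mod_net \<rho> E u" for u
  proof (rule mod_net_mono[OF _ mod_net_add[OF normed_family_Rfam mod_net_norm[OF E u] mod_net_rho_inverse_pow[of N]]])
    show "(if \<epsilon> \<in> L then w \<epsilon> else u \<epsilon>) \<in> Car E \<epsilon>" if "\<epsilon> \<in> idx" for \<epsilon>
      using w(2)[of \<epsilon>] BC[OF that] mod_net_Car[OF u that] by auto
    show "\<forall>\<^sub>F \<epsilon> in small. nm E \<epsilon> (if \<epsilon> \<in> L then w \<epsilon> else u \<epsilon>) \<le> nm E \<epsilon> (u \<epsilon>) + inverse (\<rho> \<epsilon> ^ N)"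
      using N ev_idx
    proof eventually_elim
      case (elim \<epsilon>)
      have "0 \<le> nm E \<epsilon> (u \<epsilon>)" "0 < inverse (\<rho> \<epsilon> ^ N)"
        using normed_familyD(6)[OF E elim(2) mod_net_Car[OF u elim(2)]] rho(1)[OF elim(2)] by simp_all
      moreover have "nm E \<epsilon> (w \<epsilon>) \<le> inverse (\<rho> \<epsilon> ^ N)" if "\<epsilon> \<in> L" using elim(1) w(2)[OF that] by blast
      ultimately show ?case by (simp split: if_split) linarith
    qed
  qed
  define p where "p \<epsilon> = (if \<epsilon> \<in> L then w \<epsilon> else a \<epsilon>)" for \<epsilon>
  define q where "q \<epsilon> = (if \<epsilon> \<in> L then w \<epsilon> else b \<epsilon>)" for \<epsilon>
  have pq: "mod_net \<rho> E p" "mod_net \<rho> E q" unfolding p_def q_def by (intro patch a b)+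
  have "\<forall>\<^sub>F \<epsilon> in small. p \<epsilon> \<in> inner_part \<rho> E A (max m n) \<epsilon>"
    using a(2) ev_idx
  proof eventually_elim
    case (elim \<epsilon>)
    \<comment> \<open>On \<open>L\<close> the net \<open>p\<close> lies in the inner part of index
      \<open>n\<close>, off \<open>L\<close> in that of index \<open>m\<close>; a single index is
      needed for strong internality.\<close>
    have "inner_part \<rho> E A m \<epsilon> \<subseteq> inner_part \<rho> E A (max m n) \<epsilon>"
      "inner_part \<rho> E A n \<epsilon> \<subseteq> inner_part \<rho> E A (max m n) \<epsilon>"
      by (rule inner_part_mono[OF elim(2)]; simp)+
    then show ?case using elim(1) w(1)[of \<epsilon>] unfolding p_def by (cases "\<epsilon> \<in> L") auto
  qed
  then have "cls \<rho> E idx p \<in> strongly_internal \<rho> E A"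
    by (rule inner_part_imp_strongly_internal[OF E pq(1)])
  moreover have "\<forall>\<^sub>F \<epsilon> in small. q \<epsilon> \<in> B \<epsilon>" using b(2) by eventually_elim (simp add: q_def w)
  then have "cls \<rho> E idx q \<in> internal \<rho> E B" by (rule internalI[OF E pq(2)])
  moreover have "grestrict \<rho> E L (cls \<rho> E idx p) = grestrict \<rho> E L (cls \<rho> E idx q)"
    by (intro antisym grestrict_subset[OF E L(1)] pq) (simp_all add: p_def q_def)
  ultimately show False using disj L unfolding strongly_disjoint_def by blast
qed

section \<open>The sharp topology\<close>

lemma topspace_sharp:
  assumes E: "normed_family E"
  shows "topspace (sharp_topology \<rho> E) = G \<rho> E idx"
proof -
  have "x \<in> gball \<rho> E (rconst \<rho> 1) x" if x: "x \<in> G \<rho> E idx" for x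
  proof -
    obtain u where u: "mod_net \<rho> E u" "x = cls \<rho> E idx u" using GE[OF E x] .
    have "\<forall>\<^sub>F \<epsilon> in small. nm E \<epsilon> (u \<epsilon> - u \<epsilon>) + \<rho> \<epsilon> ^ 0 \<le> 1"
      using ev_idx by eventually_elim (simp add: normed_familyD(8)[OF E] del: greaterThanAtMost_iff)
    then show ?thesis using mem_gball_iff[OF E mod_net_const u(1) u(1), of 1] unfolding u(2) rconst_def by blast
  qed
  moreover have "rpos \<rho> (rconst \<rho> 1)"
    unfolding rconst_def rpos_cls_iff[OF mod_net_const] by (rule exI[of _ 0]) simp
  moreover have "rconst \<rho> 1 \<in> Rt \<rho>" unfolding rconst_def by (simp add: cls_in_G)
  ultimately show ?thesis
    unfolding sharp_topology_def topology_generated_by_topspace by (auto simp: gball_def)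
qed

text \<open>The balls whose radius is the class of a power of the gauge suffice as neighbourhoods,
  and a class in such a ball has all the closeness that \<open>near\<close> demands of its
  representative. Openness can thus be tested on nets.\<close>

lemma openin_sharpI:
  assumes E: "normed_family E" and U: "U \<subseteq> G \<rho> E idx"
    and near: "\<And>u. mod_net \<rho> E u \<Longrightarrow> cls \<rho> E idx u \<in> U \<Longrightarrow>
      \<exists>k. \<forall>v. mod_net \<rho> E v \<longrightarrow> (\<forall>\<^sub>F \<epsilon> in small. nm E \<epsilon> (u \<epsilon> - v \<epsilon>) \<le> \<rho> \<epsilon> ^ k) \<longrightarrow> cls \<rho> E idx v \<in> U"
  shows "openin (sharp_topology \<rho> E) U"
proof (subst openin_subopen, intro ballI)
  fix x assume x: "x \<in> U"
  then obtain u where u: "mod_net \<rho> E u" "x = cls \<rho> E idx u" using GE[OF E] U by blast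
  obtain k where k: "\<And>v. mod_net \<rho> E v \<Longrightarrow> (\<forall>\<^sub>F \<epsilon> in small. nm E \<epsilon> (u \<epsilon> - v \<epsilon>) \<le> \<rho> \<epsilon> ^ k) \<Longrightarrow> cls \<rho> E idx v \<in> U"
    using near[OF u(1)] x u(2) by blast
  define r where "r = cls \<rho> Rfam idx (\<lambda>\<epsilon>. \<rho> \<epsilon> ^ k)"
  have r: "r \<in> Rt \<rho>" "rpos \<rho> r"
    unfolding r_def by (auto simp: cls_in_G rpos_cls_iff intro!: exI[of _ k])
  have "openin (sharp_topology \<rho> E) (gball \<rho> E r x)"
    unfolding sharp_topology_def openin_topology_generated_by_iff
    by (rule generate_topology_on.Basis) (use r x U in blast)
  moreover have "x \<in> gball \<rho> E r x"
  proof -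
    have "\<forall>\<^sub>F \<epsilon> in small. nm E \<epsilon> (u \<epsilon> - u \<epsilon>) + \<rho> \<epsilon> ^ k \<le> \<rho> \<epsilon> ^ k"
      using ev_idx by eventually_elim (simp add: normed_familyD(8)[OF E] del: greaterThanAtMost_iff)
    then show ?thesis unfolding r_def u(2) mem_gball_iff[OF E mod_net_rho_pow u(1) u(1)] ..
  qed
  moreover have "gball \<rho> E r x \<subseteq> U"
  proof
    fix y assume y: "y \<in> gball \<rho> E r x"
    then obtain v where v: "mod_net \<rho> E v" "y = cls \<rho> E idx v" using GE[OF E] unfolding gball_def by blast
    obtain j where "\<forall>\<^sub>F \<epsilon> in small. nm E \<epsilon> (u \<epsilon> - v \<epsilon>) + \<rho> \<epsilon> ^ j \<le> \<rho> \<epsilon> ^ k"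
      using y unfolding r_def u(2) v(2) mem_gball_iff[OF E mod_net_rho_pow u(1) v(1)] ..
    then have "\<forall>\<^sub>F \<epsilon> in small. nm E \<epsilon> (u \<epsilon> - v \<epsilon>) \<le> \<rho> \<epsilon> ^ k" using ev_idx
    proof eventually_elim
      case (elim \<epsilon>)
      have "0 < \<rho> \<epsilon> ^ j" using rho(1)[OF elim(2)] by simp
      then show ?case using elim(1) by simp
    qed
    then show "y \<in> U" using k v by blast
  qed
  ultimately show "\<exists>T. openin (sharp_topology \<rho> E) T \<and> x \<in> T \<and> T \<subseteq> U" by blast
qed

end

section \<open>Maps induced by nets of functionals\<close>

definition lift_map :: "(real \<Rightarrow> real) \<Rightarrow> (real \<Rightarrow> 'a \<Rightarrow> real) \<Rightarrow> (real \<Rightarrow> 'a) set \<Rightarrow> (real \<Rightarrow> real) set" where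
  "lift_map \<rho> \<phi> x = (\<Union>u\<in>x. cls \<rho> Rfam idx (\<lambda>\<epsilon>. \<phi> \<epsilon> (u \<epsilon>)))"

text \<open>The operator norms are bounded by one negative power of the gauge. The conditions hold
  on the whole index set, not just for small indices, as \<open>represented_by\<close> requires
  linearity everywhere.\<close>

locale functional_net = gauge \<rho> for \<rho> +
  fixes E :: "'a::real_vector nfam" and \<phi> :: "real \<Rightarrow> 'a \<Rightarrow> real" and N :: nat
  assumes E: "normed_family E"
    and linear: "\<And>\<epsilon>. \<epsilon> \<in> idx \<Longrightarrow> linear_on_set (Car E \<epsilon>) (\<phi> \<epsilon>)"
    and bound: "\<And>\<epsilon> v. \<epsilon> \<in> idx \<Longrightarrow> v \<in> Car E \<epsilon> \<Longrightarrow> \<bar>\<phi> \<epsilon> v\<bar> \<le> inverse (\<rho> \<epsilon> ^ N) * nm E \<epsilon> v"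
begin

lemma phi_add: "\<epsilon> \<in> idx \<Longrightarrow> x \<in> Car E \<epsilon> \<Longrightarrow> y \<in> Car E \<epsilon> \<Longrightarrow> \<phi> \<epsilon> (x + y) = \<phi> \<epsilon> x + \<phi> \<epsilon> y"
  and phi_scale: "\<epsilon> \<in> idx \<Longrightarrow> x \<in> Car E \<epsilon> \<Longrightarrow> \<phi> \<epsilon> (c *\<^sub>R x) = c * \<phi> \<epsilon> x"
  using linear unfolding linear_on_set_def by blast+

lemma phi_diff: "\<epsilon> \<in> idx \<Longrightarrow> x \<in> Car E \<epsilon> \<Longrightarrow> y \<in> Car E \<epsilon> \<Longrightarrow> \<phi> \<epsilon> (x - y) = \<phi> \<epsilon> x - \<phi> \<epsilon> y"
  using phi_add[of \<epsilon> "x - y" y] normed_familyD(4)[OF E] by simp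

lemma mod_net_phi:
  assumes u: "mod_net \<rho> E u"
  shows "mod_net \<rho> Rfam (\<lambda>\<epsilon>. \<phi> \<epsilon> (u \<epsilon>))"
proof (rule mod_net_mono[OF _ mod_net_scale[OF normed_family_Rfam mod_net_rho_inverse_pow[of N] mod_net_norm[OF E u]]])
  show "\<forall>\<^sub>F \<epsilon> in small. nm Rfam \<epsilon> (\<phi> \<epsilon> (u \<epsilon>)) \<le> inverse (\<rho> \<epsilon> ^ N) *\<^sub>R nm E \<epsilon> (u \<epsilon>)"
    using ev_idx
  proof eventually_elim
    case (elim \<epsilon>)
    show ?case using bound[OF elim mod_net_Car[OF u elim]] by simp
  qed
qed simp

lemma negl_net_phi:
  assumes u: "negl_net \<rho> E u"
  shows "negl_net \<rho> Rfam (\<lambda>\<epsilon>. \<phi> \<epsilon> (u \<epsilon>))"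
proof (rule negl_net_mono[OF _ negl_net_scale_right[OF normed_family_Rfam mod_net_rho_inverse_pow[of N] negl_net_norm[OF E u]]])
  show "\<forall>\<^sub>F \<epsilon> in small. nm Rfam \<epsilon> (\<phi> \<epsilon> (u \<epsilon>)) \<le> inverse (\<rho> \<epsilon> ^ N) *\<^sub>R nm E \<epsilon> (u \<epsilon>)"
    using ev_idx
  proof eventually_elim
    case (elim \<epsilon>)
    show ?case using bound[OF elim negl_net_Car[OF u elim]] by simp
  qed
qed simp

lemma lift_map_cls:
  assumes u: "mod_net \<rho> E u"
  shows "lift_map \<rho> \<phi> (cls \<rho> E idx u) = cls \<rho> Rfam idx (\<lambda>\<epsilon>. \<phi> \<epsilon> (u \<epsilon>))"
  unfolding lift_map_def
proof (rule UN_cls_eq[OF E u])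
  fix w assume w: "mod_net \<rho> E w" "negl_net \<rho> E (\<lambda>\<epsilon>. u \<epsilon> - w \<epsilon>)"
  have "negl_net \<rho> Rfam (\<lambda>\<epsilon>. \<phi> \<epsilon> (w \<epsilon> - u \<epsilon>))"
    by (rule negl_net_phi[OF negl_net_minus_commute[OF E w(2)]])
  then have "negl_net \<rho> Rfam (\<lambda>\<epsilon>. \<phi> \<epsilon> (w \<epsilon>) - \<phi> \<epsilon> (u \<epsilon>))"
    by (rule iffD1[OF negl_net_cong, rotated]) (rule phi_diff; use mod_net_Car u w(1) in blast)
  then show "cls \<rho> Rfam idx (\<lambda>\<epsilon>. \<phi> \<epsilon> (w \<epsilon>)) = cls \<rho> Rfam idx (\<lambda>\<epsilon>. \<phi> \<epsilon> (u \<epsilon>))"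
    using cls_eq_iff[OF normed_family_Rfam] mod_net_phi u w(1) by blast
qed

lemma Rt_linear_lift_map: "Rt_linear \<rho> E (lift_map \<rho> \<phi>)"
  unfolding Rt_linear_def
proof (intro conjI ballI funcsetI)
  note R = normed_family_Rfam
  fix x assume "x \<in> G \<rho> E idx"
  then obtain u where u: "mod_net \<rho> E u" "x = cls \<rho> E idx u" by (rule GE[OF E])
  show "lift_map \<rho> \<phi> x \<in> Rt \<rho>"
    unfolding u(2) lift_map_cls[OF u(1)] by (rule cls_in_G[OF R mod_net_phi[OF u(1)]])
  show "lift_map \<rho> \<phi> (gadd \<rho> E x y) = gadd \<rho> Rfam (lift_map \<rho> \<phi> x) (lift_map \<rho> \<phi> y)"
    if y: "y \<in> G \<rho> E idx" for y
  proof -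
    obtain v where v: "mod_net \<rho> E v" "y = cls \<rho> E idx v" using y by (rule GE[OF E])
    show ?thesis
      unfolding u(2) v(2) gadd_cls[OF E u(1) v(1)] lift_map_cls[OF u(1)] lift_map_cls[OF v(1)]
        lift_map_cls[OF mod_net_add[OF E u(1) v(1)]]
        gadd_cls[OF R mod_net_phi[OF u(1)] mod_net_phi[OF v(1)]]
      by (rule cls_cong) (rule phi_add; use mod_net_Car u v in blast)
  qed
next
  note R = normed_family_Rfam
  fix c x assume "c \<in> Rt \<rho>" "x \<in> G \<rho> E idx"
  then obtain a u where u: "mod_net \<rho> E u" "x = cls \<rho> E idx u" and a: "mod_net \<rho> Rfam a" "c = cls \<rho> Rfam idx a"
    using GE[OF E] GE[OF R] by metis
  show "lift_map \<rho> \<phi> (gscale \<rho> E c x) = gscale \<rho> Rfam c (lift_map \<rho> \<phi> x)"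
    unfolding u(2) a(2) gscale_cls[OF E a(1) u(1)] lift_map_cls[OF u(1)]
      lift_map_cls[OF mod_net_scale[OF E a(1) u(1)]] gscale_cls[OF R a(1) mod_net_phi[OF u(1)]] real_scaleR_def
    by (rule cls_cong) (rule phi_scale; use mod_net_Car u in blast)
qed

lemma represented_by_lift_map: "represented_by \<rho> E (lift_map \<rho> \<phi>) \<phi>"
  unfolding represented_by_def
proof (intro conjI ballI allI)
  note R = normed_family_Rfam
  show "(\<lambda>\<epsilon>\<in>idx. \<phi> \<epsilon> (u \<epsilon>)) \<in> moderate \<rho> Rfam idx" if "u \<in> moderate \<rho> E idx" for u
    using that mod_net_phi unfolding moderate_iff[OF E] moderate_iff[OF R] restrict_mod_net by blast
  show "(\<lambda>\<epsilon>\<in>idx. \<phi> \<epsilon> (u \<epsilon>)) \<in> negligible \<rho> Rfam idx" if "u \<in> negligible \<rho> E idx" for u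
    using that negl_net_phi unfolding negligible_iff[OF E] negligible_iff[OF R] restrict_negl_net by blast
  show "lift_map \<rho> \<phi> (cls \<rho> E idx u) = cls \<rho> Rfam idx (\<lambda>\<epsilon>. \<phi> \<epsilon> (u \<epsilon>))" if "u \<in> moderate \<rho> E idx" for u
    using that lift_map_cls unfolding moderate_iff[OF E] by blast
qed (simp_all only: phi_add phi_scale)

text \<open>A Lipschitz estimate: the operator norm bound costs \<open>N\<close> powers of the
  gauge.\<close>

lemma ev_phi_near:
  assumes u: "mod_net \<rho> E u" and v: "mod_net \<rho> E v"
    and ev: "\<forall>\<^sub>F \<epsilon> in small. nm E \<epsilon> (u \<epsilon> - v \<epsilon>) \<le> \<rho> \<epsilon> ^ (k + N)"
  shows "\<forall>\<^sub>F \<epsilon> in small. \<bar>\<phi> \<epsilon> (u \<epsilon>) - \<phi> \<epsilon> (v \<epsilon>)\<bar> \<le> \<rho> \<epsilon> ^ k"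
  using ev ev_idx
proof eventually_elim
  case (elim \<epsilon>)
  have c: "u \<epsilon> \<in> Car E \<epsilon>" "v \<epsilon> \<in> Car E \<epsilon>" using mod_net_Car u v elim(2) by blast+
  have r: "0 < \<rho> \<epsilon> ^ N" using rho(1)[OF elim(2)] by simp
  have "\<bar>\<phi> \<epsilon> (u \<epsilon>) - \<phi> \<epsilon> (v \<epsilon>)\<bar> \<le> inverse (\<rho> \<epsilon> ^ N) * nm E \<epsilon> (u \<epsilon> - v \<epsilon>)"
    using bound[OF elim(2) normed_familyD(4)[OF E elim(2) c]] phi_diff[OF elim(2) c] by simp
  also have "\<dots> \<le> inverse (\<rho> \<epsilon> ^ N) * \<rho> \<epsilon> ^ (k + N)"
    using elim(1) r by (intro mult_left_mono) auto
  also have "\<dots> = \<rho> \<epsilon> ^ k" using rho(1)[OF elim(2)] by (simp add: power_add)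
  finally show ?case .
qed

text \<open>Membership in a ball comes with a margin of power \<open>k\<close> of the gauge. Moving
  \<open>u\<close> by the power \<open>Suc k + N\<close> moves its image by the power
  \<open>Suc k\<close>; since twice that power is eventually at most the power \<open>k\<close>, a
  margin of power \<open>Suc k\<close> survives.\<close>

lemma continuous_map_lift_map: "continuous_map (sharp_topology \<rho> E) (sharp_topology \<rho> Rfam) (lift_map \<rho> \<phi>)"
proof -
  note R = normed_family_Rfam
  let ?\<B> = "{gball \<rho> Rfam r u |r u. r \<in> Rt \<rho> \<and> rpos \<rho> r \<and> u \<in> G \<rho> Rfam idx}"
  have "lift_map \<rho> \<phi> ` topspace (sharp_topology \<rho> E) \<subseteq> topspace (sharp_topology \<rho> Rfam)"
    using Rt_linear_lift_map unfolding Rt_linear_def topspace_sharp[OF E] topspace_sharp[OF R] by blast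
  then have "lift_map \<rho> \<phi> ` topspace (sharp_topology \<rho> E) \<subseteq> \<Union>?\<B>"
    unfolding sharp_topology_def[of \<rho> Rfam] topology_generated_by_topspace .
  moreover have "openin (sharp_topology \<rho> E) (lift_map \<rho> \<phi> -` U \<inter> topspace (sharp_topology \<rho> E))"
    if "U \<in> ?\<B>" for U
    unfolding topspace_sharp[OF E]
  proof (rule openin_sharpI[OF E])
    obtain r' c' where "r' \<in> Rt \<rho>" "c' \<in> Rt \<rho>" and U': "U = gball \<rho> Rfam r' c'"
      using \<open>U \<in> ?\<B>\<close> by auto
    then obtain r c where r: "mod_net \<rho> Rfam r" "r' = cls \<rho> Rfam idx r"
      and c: "mod_net \<rho> Rfam c" "c' = cls \<rho> Rfam idx c"
      using GE[OF R] by metis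
    have mem: "cls \<rho> E idx v \<in> lift_map \<rho> \<phi> -` U \<inter> G \<rho> E idx \<longleftrightarrow>
      (\<exists>k. \<forall>\<^sub>F \<epsilon> in small. \<bar>c \<epsilon> - \<phi> \<epsilon> (v \<epsilon>)\<bar> + \<rho> \<epsilon> ^ k \<le> r \<epsilon>)" if "mod_net \<rho> E v" for v
      using mem_gball_iff[OF R r(1) c(1) mod_net_phi[OF that]] cls_in_G[OF E that]
      by (simp add: U' r(2) c(2) lift_map_cls[OF that])
    fix u assume u: "mod_net \<rho> E u" "cls \<rho> E idx u \<in> lift_map \<rho> \<phi> -` U \<inter> G \<rho> E idx"
    then obtain k where k: "\<forall>\<^sub>F \<epsilon> in small. \<bar>c \<epsilon> - \<phi> \<epsilon> (u \<epsilon>)\<bar> + \<rho> \<epsilon> ^ k \<le> r \<epsilon>" using mem by blast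
    have "cls \<rho> E idx v \<in> lift_map \<rho> \<phi> -` U \<inter> G \<rho> E idx"
      if v: "mod_net \<rho> E v" "\<forall>\<^sub>F \<epsilon> in small. nm E \<epsilon> (u \<epsilon> - v \<epsilon>) \<le> \<rho> \<epsilon> ^ (Suc k + N)" for v
    proof -
      have "\<forall>\<^sub>F \<epsilon> in small. \<bar>c \<epsilon> - \<phi> \<epsilon> (v \<epsilon>)\<bar> + \<rho> \<epsilon> ^ Suc k \<le> r \<epsilon>"
        using k ev_phi_near[OF u(1) v] ev_absorb(1)[of 2 k, OF zero_less_numeral]
        by eventually_elim linarith
      then show ?thesis using mem[OF v(1)] by blast
    qed
    then show "\<exists>k. \<forall>v. mod_net \<rho> E v \<longrightarrow> (\<forall>\<^sub>F \<epsilon> in small. nm E \<epsilon> (u \<epsilon> - v \<epsilon>) \<le> \<rho> \<epsilon> ^ k)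
        \<longrightarrow> cls \<rho> E idx v \<in> lift_map \<rho> \<phi> -` U \<inter> G \<rho> E idx"
      by blast
  qed simp
  ultimately show ?thesis
    unfolding sharp_topology_def[of \<rho> Rfam] continuous_on_generated_topo_iff by blast
qed

text \<open>Off the level set, for some \<open>k\<close> the difference from \<open>\<beta>\<close>
  fails to stay below the power \<open>k\<close> of the gauge. A nearby class on the level set would
  force that bound by the triangle inequality, so the complement is open.\<close>

lemma closedin_level_set_lift_map:
  assumes "\<alpha> \<in> Rt \<rho>"
  shows "closedin (sharp_topology \<rho> E) (level_set \<rho> E (lift_map \<rho> \<phi>) \<alpha>)"
proof -
  note R = normed_family_Rfam
  obtain \<beta> where \<beta>: "mod_net \<rho> Rfam \<beta>" "\<alpha> = cls \<rho> Rfam idx \<beta>" using GE[OF R assms] .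
  let ?U = "G \<rho> E idx - level_set \<rho> E (lift_map \<rho> \<phi>) \<alpha>"
  have mem: "cls \<rho> E idx v \<in> ?U \<longleftrightarrow> \<not> negl_net \<rho> Rfam (\<lambda>\<epsilon>. \<phi> \<epsilon> (v \<epsilon>) - \<beta> \<epsilon>)"
    if v: "mod_net \<rho> E v" for v
    using cls_in_G[OF E v] by (simp add: level_set_def lift_map_cls[OF v] \<beta>(2) cls_eq_iff[OF R mod_net_phi[OF v] \<beta>(1)])
  have "openin (sharp_topology \<rho> E) ?U"
  proof (rule openin_sharpI[OF E])
    fix u assume u: "mod_net \<rho> E u" "cls \<rho> E idx u \<in> ?U"
    obtain k where k: "\<not> (\<forall>\<^sub>F \<epsilon> in small. \<bar>\<phi> \<epsilon> (u \<epsilon>) - \<beta> \<epsilon>\<bar> \<le> \<rho> \<epsilon> ^ k)"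
      using u(2) unfolding mem[OF u(1)] negl_net_def by auto
    have "cls \<rho> E idx v \<in> ?U"
      if v: "mod_net \<rho> E v" "\<forall>\<^sub>F \<epsilon> in small. nm E \<epsilon> (u \<epsilon> - v \<epsilon>) \<le> \<rho> \<epsilon> ^ (Suc k + N)" for v
    proof (rule ccontr)
      assume "cls \<rho> E idx v \<notin> ?U"
      then have "negl_net \<rho> Rfam (\<lambda>\<epsilon>. \<phi> \<epsilon> (v \<epsilon>) - \<beta> \<epsilon>)" using mem[OF v(1)] by blast
      from negl_netD[OF this, of "Suc k", unfolded Rfam_simps]
        ev_phi_near[OF u(1) v] ev_absorb(1)[of 2 k, OF zero_less_numeral]
      have "\<forall>\<^sub>F \<epsilon> in small. \<bar>\<phi> \<epsilon> (u \<epsilon>) - \<beta> \<epsilon>\<bar> \<le> \<rho> \<epsilon> ^ k"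
        by eventually_elim linarith
      with k show False ..
    qed
    then show "\<exists>k. \<forall>v. mod_net \<rho> E v \<longrightarrow> (\<forall>\<^sub>F \<epsilon> in small. nm E \<epsilon> (u \<epsilon> - v \<epsilon>) \<le> \<rho> \<epsilon> ^ k) \<longrightarrow> cls \<rho> E idx v \<in> ?U"
      by blast
  qed blast
  then show ?thesis unfolding closedin_def topspace_sharp[OF E] by (auto simp: level_set_def)
qed

end

section \<open>The separation theorem\<close>

theorem theorem31:
  fixes \<rho> :: "real \<Rightarrow> real"
    and E :: "('a::real_vector) nfam"
    and A B :: "real \<Rightarrow> 'a set"
  assumes "gauge_net \<rho>"
    and "normed_family E"
    and "\<And>\<epsilon>. \<epsilon> \<in> idx \<Longrightarrow> A \<epsilon> \<subseteq> Car E \<epsilon>"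
    and "\<And>\<epsilon>. \<epsilon> \<in> idx \<Longrightarrow> B \<epsilon> \<subseteq> Car E \<epsilon>"
    and "strongly_internal \<rho> E A \<noteq> {}"
    and "internal \<rho> E B \<noteq> {}"
    and "strongly_disjoint \<rho> E (strongly_internal \<rho> E A) (internal \<rho> E B)"
    and "sharply_bounded \<rho> E A"
    and "sharply_bounded \<rho> E B"
    and "\<And>\<epsilon>. \<epsilon> \<in> idx \<Longrightarrow> convex (A \<epsilon>)"
    and "\<And>\<epsilon>. \<epsilon> \<in> idx \<Longrightarrow> convex (B \<epsilon>)"
  shows "\<exists>f \<alpha>. Rt_linear \<rho> E f
    \<and> (\<exists>\<phi>. represented_by \<rho> E f \<phi>)
    \<and> continuous_map (sharp_topology \<rho> E) (sharp_topology \<rho> Rfam) f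
    \<and> non_identically_null \<rho> E f
    \<and> \<alpha> \<in> Rt \<rho>
    \<and> closedin (sharp_topology \<rho> E) (level_set \<rho> E f \<alpha>)
    \<and> (\<forall>y\<in>strongly_internal \<rho> E A. \<forall>z\<in>internal \<rho> E B. rle (f y) \<alpha> \<and> rle \<alpha> (f z))
    \<and> (gcone \<rho> E (internal \<rho> E B) \<longrightarrow> \<alpha> = rconst \<rho> 0)"
proof -
  interpret gauge \<rho> by (rule gauge.intro) (rule assms(1))
  note E = assms(2) and R = normed_family_Rfam
  obtain x where x: "x \<in> strongly_internal \<rho> E A" using assms(5) by blast
  then have "x \<in> G \<rho> E idx" by (simp add: strongly_internal_def)
  then obtain a where a: "mod_net \<rho> E a" "x = cls \<rho> E idx a" by (rule GE[OF E])
  obtain m\<^sub>0 where m0: "\<forall>\<^sub>F \<epsilon> in small. a \<epsilon> \<in> inner_part \<rho> E A m\<^sub>0 \<epsilon>"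
    using strongly_internal_imp_inner_part[OF E a(1)] x a(2) by blast
  obtain b where b: "mod_net \<rho> E b" "cls \<rho> E idx b \<in> internal \<rho> E B" "\<forall>\<^sub>F \<epsilon> in small. b \<epsilon> \<in> B \<epsilon>"
    using assms(6) internalE[OF E] by (metis ex_in_conv)
  have disj: "\<forall>\<^sub>F \<epsilon> in small. inner_part \<rho> E A n \<epsilon> \<inter> B \<epsilon> = {}" for n
    by (rule strongly_disjoint_imp_inner_part_disjoint[OF E assms(7) _ assms(9) a(1) m0 b(1,3)])
      (rule assms(4))
  \<comment> \<open>One more power halves the radius: two steps of size power \<open>m\<close> from
    \<open>a\<close> stay within power \<open>m\<^sub>0\<close>, so the ball of radius power
    \<open>m\<close> around \<open>a\<close> lies in the inner part of index
    \<open>m\<close>.\<close>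
  define m where "m = Suc m\<^sub>0"
  \<comment> \<open>The indices at which separation can be carried out. The second condition places
    the inner part of index \<open>m\<close>, and with it the ball around \<open>a\<close>, inside
    the set \<open>C\<close> below.\<close>
  define good where "good \<epsilon> \<longleftrightarrow> b \<epsilon> \<in> B \<epsilon> \<and> inner_part \<rho> E A m \<epsilon> \<inter> B \<epsilon> = {}
    \<and> (\<forall>x\<in>Car E \<epsilon>. nm E \<epsilon> (x - a \<epsilon>) \<le> \<rho> \<epsilon> ^ m \<longrightarrow> x \<in> inner_part \<rho> E A m \<epsilon>)" for \<epsilon>
  have ev_good: "\<forall>\<^sub>F \<epsilon> in small. good \<epsilon>"
    using b(3) disj[of m] m0 ev_absorb(1)[of 2 m\<^sub>0, OF zero_less_numeral] ev_idx
  proof eventually_elim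
    case (elim \<epsilon>)
    note D = normed_familyD[OF E elim(5)]
    have aC: "a \<epsilon> \<in> Car E \<epsilon>" by (rule mod_net_Car[OF a(1) elim(5)])
    have "x \<in> inner_part \<rho> E A m \<epsilon>" if x: "x \<in> Car E \<epsilon>" "nm E \<epsilon> (x - a \<epsilon>) \<le> \<rho> \<epsilon> ^ m" for x
    proof -
      have "y \<in> A \<epsilon>" if y: "y \<in> Car E \<epsilon>" "nm E \<epsilon> (y - x) \<le> \<rho> \<epsilon> ^ m" for y
      proof -
        have "nm E \<epsilon> (y - a \<epsilon>) \<le> nm E \<epsilon> (y - x) + nm E \<epsilon> (x - a \<epsilon>)"
          using D(9)[OF D(4)[OF y(1) x(1)] D(4)[OF x(1) aC]] by simp
        then have "nm E \<epsilon> (y - a \<epsilon>) \<le> \<rho> \<epsilon> ^ m\<^sub>0" using x(2) y(2) elim(4) unfolding m_def by linarith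
        then show ?thesis using elim(3) y(1) unfolding inner_part_def by blast
      qed
      then show ?thesis using x(1) unfolding inner_part_def by blast
    qed
    then show ?case using elim(1,2) unfolding good_def by blast
  qed
  \<comment> \<open>Each inner part eventually misses \<open>B\<close>, but from a threshold that
    depends on \<open>n\<close>. Joining at each index exactly those that miss \<open>B\<close>
    gives one set that serves all \<open>n\<close> at once.\<close>
  define C where "C \<epsilon> = \<Union>{inner_part \<rho> E A n \<epsilon> |n. inner_part \<rho> E A n \<epsilon> \<inter> B \<epsilon> = {}}" for \<epsilon>
  \<comment> \<open>Linearity and the norm bound are demanded at every index, separation only at
    good ones; elsewhere the zero functional serves as default.\<close>
  define sep where "sep \<epsilon> f t \<longleftrightarrow> linear_on_set (Car E \<epsilon>) f
    \<and> (\<forall>v\<in>Car E \<epsilon>. \<bar>f v\<bar> \<le> inverse (\<rho> \<epsilon> ^ m) * nm E \<epsilon> v)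
    \<and> (good \<epsilon> \<longrightarrow> f (b \<epsilon> - a \<epsilon>) = 1 \<and> (\<forall>x\<in>C \<epsilon>. f x \<le> t) \<and> (\<forall>z\<in>B \<epsilon>. t \<le> f z))" for \<epsilon> f t
  have "\<exists>f t. sep \<epsilon> f t" if e: "\<epsilon> \<in> idx" for \<epsilon>
  proof (cases "good \<epsilon>")
    case True
    note D = normed_familyD[OF E e]
    have r: "0 < \<rho> \<epsilon> ^ m" using rho(1)[OF e] by simp
    have C: "convex (C \<epsilon>)" unfolding C_def by (rule convex_UN_inner_part[OF E e, where A = A, OF assms(10)[OF e]])
    have CV: "C \<epsilon> \<subseteq> Car E \<epsilon>" and CB: "C \<epsilon> \<inter> B \<epsilon> = {}" unfolding C_def inner_part_def by blast+
    have bB: "b \<epsilon> \<in> B \<epsilon>" using True unfolding good_def by blast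
    have ball: "x \<in> C \<epsilon>" if "x \<in> Car E \<epsilon>" "nm E \<epsilon> (x - a \<epsilon>) \<le> \<rho> \<epsilon> ^ m" for x
      using True that unfolding good_def C_def by blast
    obtain f t where "linear_on_set (Car E \<epsilon>) f" "f (b \<epsilon> - a \<epsilon>) = 1"
      "\<And>v. v \<in> Car E \<epsilon> \<Longrightarrow> \<bar>f v\<bar> \<le> nm E \<epsilon> v / \<rho> \<epsilon> ^ m"
      "\<And>x. x \<in> C \<epsilon> \<Longrightarrow> f x \<le> t" "\<And>z. z \<in> B \<epsilon> \<Longrightarrow> t \<le> f z"
      by (rule normed_separation[where n = "nm E \<epsilon>", OF D(1) D(6) D(7) D(10) C CV
            assms(11)[OF e] assms(4)[OF e] CB mod_net_Car[OF a(1) e] bB r ball]) (assumption | rule that)+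
    then have "sep \<epsilon> f t" unfolding sep_def by (simp add: divide_inverse mult.commute)
    then show ?thesis by blast
  next
    case False
    have "sep \<epsilon> (\<lambda>_. 0) 0"
      using False normed_familyD(6)[OF E e] rho(1)[OF e] unfolding sep_def linear_on_set_def by simp
    then show ?thesis by blast
  qed
  then obtain \<phi> \<beta> where sep: "\<And>\<epsilon>. \<epsilon> \<in> idx \<Longrightarrow> sep \<epsilon> (\<phi> \<epsilon>) (\<beta> \<epsilon>)" by metis
  interpret functional_net \<rho> E \<phi> m
    by unfold_locales (use E sep in \<open>auto simp: sep_def\<close>)
  have ev_sep: "\<forall>\<^sub>F \<epsilon> in small. \<phi> \<epsilon> (b \<epsilon> - a \<epsilon>) = 1 \<and> (\<forall>x\<in>C \<epsilon>. \<phi> \<epsilon> x \<le> \<beta> \<epsilon>) \<and> (\<forall>z\<in>B \<epsilon>. \<beta> \<epsilon> \<le> \<phi> \<epsilon> z)"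
    using ev_good ev_idx by eventually_elim (use sep in \<open>unfold sep_def, blast\<close>)
  \<comment> \<open>For fixed \<open>n\<close> the inner part is eventually one of the sets joined
    in \<open>C\<close>.\<close>
  have ev_inner: "\<forall>\<^sub>F \<epsilon> in small. \<phi> \<epsilon> (u \<epsilon>) \<le> \<beta> \<epsilon>"
    if "\<forall>\<^sub>F \<epsilon> in small. u \<epsilon> \<in> inner_part \<rho> E A n \<epsilon>" for u n
    using that disj[of n] ev_sep
  proof eventually_elim
    case (elim \<epsilon>)
    then have "u \<epsilon> \<in> C \<epsilon>" unfolding C_def by blast
    with elim show ?case by blast
  qed
  \<comment> \<open>The level is eventually caught between the moderate values of the functional at
    \<open>a\<close> and at \<open>b\<close>.\<close>
  have \<beta>: "mod_net \<rho> Rfam \<beta>"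
  proof (rule mod_net_mono[OF _ mod_net_add[OF R mod_net_norm[OF R mod_net_phi[OF a(1)]]
          mod_net_norm[OF R mod_net_phi[OF b(1)]]]])
    show "\<forall>\<^sub>F \<epsilon> in small. nm Rfam \<epsilon> (\<beta> \<epsilon>) \<le> nm Rfam \<epsilon> (\<phi> \<epsilon> (a \<epsilon>)) + nm Rfam \<epsilon> (\<phi> \<epsilon> (b \<epsilon>))"
      using ev_inner[OF m0] ev_sep b(3)
    proof eventually_elim
      case (elim \<epsilon>)
      then have "\<phi> \<epsilon> (a \<epsilon>) \<le> \<beta> \<epsilon>" "\<beta> \<epsilon> \<le> \<phi> \<epsilon> (b \<epsilon>)" by blast+
      then show ?case by simp
    qed
  qed simp
  define f where "f = lift_map \<rho> \<phi>"
  \<comment> \<open>In the cone case the functional stays the same and only the level moves to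
    0.\<close>
  define \<alpha> where "\<alpha> = (if gcone \<rho> E (internal \<rho> E B) then rconst \<rho> 0 else cls \<rho> Rfam idx \<beta>)"
  have \<alpha>: "\<alpha> \<in> Rt \<rho>" unfolding \<alpha>_def rconst_def using \<beta> by (simp add: cls_in_G)
  have null: "non_identically_null \<rho> E f"
  proof -
    note ba = mod_net_diff[OF E b(1) a(1)]
    have "\<forall>\<^sub>F \<epsilon> in small. \<rho> \<epsilon> ^ 0 \<le> nm Rfam \<epsilon> (\<phi> \<epsilon> (b \<epsilon> - a \<epsilon>))"
      using ev_sep by eventually_elim simp
    then have "rpos \<rho> (gnorm \<rho> Rfam (f (cls \<rho> E idx (\<lambda>\<epsilon>. b \<epsilon> - a \<epsilon>))))"
      unfolding f_def lift_map_cls[OF ba] gnorm_cls[OF R mod_net_phi[OF ba]]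
        rpos_cls_iff[OF mod_net_norm[OF R mod_net_phi[OF ba]]] by blast
    then show ?thesis unfolding non_identically_null_def using cls_in_G[OF E ba] by blast
  qed
  \<comment> \<open>An arbitrary representative \<open>v\<close> need not lie in \<open>B\<close>;
    comparison with a representative \<open>w\<close> that does costs a negligible error, hence at
    most any power \<open>j\<close> of the gauge.\<close>
  have ev_B: "\<forall>\<^sub>F \<epsilon> in small. \<beta> \<epsilon> \<le> \<phi> \<epsilon> (v \<epsilon>) + \<rho> \<epsilon> ^ j"
    if v: "mod_net \<rho> E v" "cls \<rho> E idx v \<in> internal \<rho> E B" for v j
  proof -
    obtain w where w: "mod_net \<rho> E w" "cls \<rho> E idx v = cls \<rho> E idx w" "\<forall>\<^sub>F \<epsilon> in small. w \<epsilon> \<in> B \<epsilon>"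
      using internalE[OF E v(2)] by metis
    have "cls \<rho> Rfam idx (\<lambda>\<epsilon>. \<phi> \<epsilon> (w \<epsilon>)) = cls \<rho> Rfam idx (\<lambda>\<epsilon>. \<phi> \<epsilon> (v \<epsilon>))"
      using lift_map_cls[OF v(1)] lift_map_cls[OF w(1)] w(2) by simp
    then have "negl_net \<rho> Rfam (\<lambda>\<epsilon>. \<phi> \<epsilon> (w \<epsilon>) - \<phi> \<epsilon> (v \<epsilon>))"
      using cls_eq_iff[OF R] mod_net_phi v(1) w(1) by blast
    from negl_netD[OF this, of j, unfolded Rfam_simps] w(3) ev_sep show ?thesis
    proof eventually_elim
      case (elim \<epsilon>)
      have "\<beta> \<epsilon> \<le> \<phi> \<epsilon> (w \<epsilon>)" using elim(2,3) by blast
      then show ?case using elim(1) by linarith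
    qed
  qed
  have cone_scale: "cls \<rho> E idx (\<lambda>\<epsilon>. c \<epsilon> *\<^sub>R v \<epsilon>) \<in> internal \<rho> E B"
    if cone: "gcone \<rho> E (internal \<rho> E B)" and v: "mod_net \<rho> E v" "cls \<rho> E idx v \<in> internal \<rho> E B"
      and c: "mod_net \<rho> Rfam c" "\<And>\<epsilon>. \<epsilon> \<in> idx \<Longrightarrow> 0 \<le> c \<epsilon>" for c v
  proof -
    have "\<forall>\<^sub>F \<epsilon> in small. 0 \<le> c \<epsilon> + \<rho> \<epsilon> ^ j" for j
      using ev_idx
    proof eventually_elim
      case (elim \<epsilon>)
      have "0 < \<rho> \<epsilon> ^ j" using rho(1)[OF elim] by simp
      then show ?case using c(2)[OF elim] by linarith
    qed
    then have "rle (rconst \<rho> 0) (cls \<rho> Rfam idx c)" unfolding rconst_def rle_cls_iff[OF mod_net_const c(1)] by blast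
    then show ?thesis
      using cone v(2) cls_in_G[OF R c(1)] unfolding gcone_def gscale_cls[OF E c(1) v(1), symmetric] by blast
  qed
  have below: "rle (f y) \<alpha>" if y: "y \<in> strongly_internal \<rho> E A" for y
  proof -
    have "y \<in> G \<rho> E idx" using y by (simp add: strongly_internal_def)
    then obtain u where u: "mod_net \<rho> E u" "y = cls \<rho> E idx u" by (rule GE[OF E])
    obtain n where "\<forall>\<^sub>F \<epsilon> in small. u \<epsilon> \<in> inner_part \<rho> E A n \<epsilon>"
      using strongly_internal_imp_inner_part[OF E u(1)] y u(2) by blast
    note le = ev_inner[OF this]
    have "\<forall>\<^sub>F \<epsilon> in small. \<phi> \<epsilon> (u \<epsilon>) \<le> \<beta> \<epsilon> + \<rho> \<epsilon> ^ j" for j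
      using le ev_idx
    proof eventually_elim
      case (elim \<epsilon>)
      have "0 < \<rho> \<epsilon> ^ j" using rho(1)[OF elim(2)] by simp
      then show ?case using elim(1) by linarith
    qed
    moreover have "\<forall>\<^sub>F \<epsilon> in small. \<phi> \<epsilon> (u \<epsilon>) \<le> 0 + \<rho> \<epsilon> ^ j" if cone: "gcone \<rho> E (internal \<rho> E B)" for j
    proof -
      \<comment> \<open>Scaling by 0 puts the zero class into the internal set, so the level
        \<open>\<beta>\<close> exceeds 0 by at most any given power of the gauge.\<close>
      have "cls \<rho> E idx (\<lambda>\<epsilon>. 0 *\<^sub>R b \<epsilon>) \<in> internal \<rho> E B"
        by (rule cone_scale[OF cone b(1,2)]) simp_all
      then have "\<forall>\<^sub>F \<epsilon> in small. \<beta> \<epsilon> \<le> \<phi> \<epsilon> (0 *\<^sub>R b \<epsilon>) + \<rho> \<epsilon> ^ j"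
        by (rule ev_B[OF mod_net_scale[OF E mod_net_const b(1)]])
      with le ev_idx show ?thesis
      proof eventually_elim
        case (elim \<epsilon>)
        then show ?case using phi_scale[OF elim(2) mod_net_Car[OF b(1) elim(2)], of 0] by linarith
      qed
    qed
    ultimately show ?thesis
      unfolding \<alpha>_def f_def u(2) lift_map_cls[OF u(1)] rconst_def
      by (simp add: rle_cls_iff[OF mod_net_phi[OF u(1)]] \<beta>)
  qed
  have above: "rle \<alpha> (f z)" if z: "z \<in> internal \<rho> E B" for z
  proof -
    obtain v where v: "mod_net \<rho> E v" "z = cls \<rho> E idx v" using internalE[OF E z] by metis
    have vB: "cls \<rho> E idx v \<in> internal \<rho> E B" using z v(2) by simp
    have "\<forall>\<^sub>F \<epsilon> in small. 0 \<le> \<phi> \<epsilon> (v \<epsilon>) + \<rho> \<epsilon> ^ j" if cone: "gcone \<rho> E (internal \<rho> E B)" for j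
    proof -
      obtain K where K: "\<forall>\<^sub>F \<epsilon> in small. nm Rfam \<epsilon> (\<beta> \<epsilon>) \<le> inverse (\<rho> \<epsilon> ^ K)" using mod_netD[OF \<beta>] .
      \<comment> \<open>The separation at \<open>v\<close> scaled by the inverse of power
        \<open>k\<close> bounds the scaled value below by minus twice the inverse of power
        \<open>K\<close>. Multiplying back leaves an error of twice the power \<open>Suc j\<close>,
        which is eventually at most the power \<open>j\<close>.\<close>
      define k where "k = Suc j + K"
      have "cls \<rho> E idx (\<lambda>\<epsilon>. inverse (\<rho> \<epsilon> ^ k) *\<^sub>R v \<epsilon>) \<in> internal \<rho> E B"
        by (rule cone_scale[OF cone v(1) vB]) (use rho(1) in \<open>simp_all add: less_imp_le\<close>)
      then have "\<forall>\<^sub>F \<epsilon> in small. \<beta> \<epsilon> \<le> \<phi> \<epsilon> (inverse (\<rho> \<epsilon> ^ k) *\<^sub>R v \<epsilon>) + \<rho> \<epsilon> ^ 0"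
        by (rule ev_B[OF mod_net_scale[OF E mod_net_rho_inverse_pow v(1)]])
      with K ev_absorb(1)[of 2 j, OF zero_less_numeral] ev_idx show ?thesis
      proof eventually_elim
        case (elim \<epsilon>)
        have q: "0 < \<rho> \<epsilon> ^ k" "0 < \<rho> \<epsilon> ^ K" using rho(1)[OF elim(3)] by simp_all
        have "1 \<le> inverse (\<rho> \<epsilon> ^ K)" using rho_inv_mono[OF elim(3), of 0 K] by simp
        then have "0 \<le> inverse (\<rho> \<epsilon> ^ k) * \<phi> \<epsilon> (v \<epsilon>) + 2 * inverse (\<rho> \<epsilon> ^ K)"
          using elim(1,4) phi_scale[OF elim(3) mod_net_Car[OF v(1) elim(3)]] by simp
        then have "0 \<le> \<rho> \<epsilon> ^ k * (inverse (\<rho> \<epsilon> ^ k) * \<phi> \<epsilon> (v \<epsilon>) + 2 * inverse (\<rho> \<epsilon> ^ K))"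
          using q by simp
        also have "\<dots> = \<phi> \<epsilon> (v \<epsilon>) + 2 * (\<rho> \<epsilon> ^ k * inverse (\<rho> \<epsilon> ^ K))"
          using rho(1)[OF elim(3)] by (simp add: distrib_left)
        also have "\<rho> \<epsilon> ^ k * inverse (\<rho> \<epsilon> ^ K) = \<rho> \<epsilon> ^ Suc j"
          using rho(1)[OF elim(3)] unfolding k_def power_add by simp
        finally show ?case using elim(2) by linarith
      qed
    qed
    then show ?thesis
      unfolding \<alpha>_def f_def v(2) lift_map_cls[OF v(1)] rconst_def
      by (simp add: rle_cls_iff[OF _ mod_net_phi[OF v(1)]] \<beta> ev_B[OF v(1) vB])
  qed
  have "Rt_linear \<rho> E f \<and> (\<exists>\<phi>. represented_by \<rho> E f \<phi>)
    \<and> continuous_map (sharp_topology \<rho> E) (sharp_topology \<rho> Rfam) f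
    \<and> non_identically_null \<rho> E f \<and> \<alpha> \<in> Rt \<rho>
    \<and> closedin (sharp_topology \<rho> E) (level_set \<rho> E f \<alpha>)
    \<and> (\<forall>y\<in>strongly_internal \<rho> E A. \<forall>z\<in>internal \<rho> E B. rle (f y) \<alpha> \<and> rle \<alpha> (f z))
    \<and> (gcone \<rho> E (internal \<rho> E B) \<longrightarrow> \<alpha> = rconst \<rho> 0)"
    using Rt_linear_lift_map represented_by_lift_map continuous_map_lift_map
      closedin_level_set_lift_map[OF \<alpha>] null \<alpha> below above
    unfolding f_def[symmetric] by (auto simp: \<alpha>_def)
  then show ?thesis by blast
qed

end
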